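(* There is an algorithm that, given an $n$-permutation $\pi$, computes $rank(\pi)$ in $\mathcal{O}(n\sqrt{\log n})$ time.
   Context: Fix an integer $n\ge 5$. An $n$-permutation is a sequence $(a_1,\dots,a_n)$ of the distinct elements of $\{1,\dots,n\}$. For $\pi=(a_1,\dots,a_n)$ put $\sigma(\pi)=(a_2,\dots,a_n,a_1)$ and $\tau(\pi)=(a_2,a_1,a_3,\dots,a_n)$. On $\{1,\dots,n-1\}$ let $a\oplus 1=a+1$ for $a<n-1$ and $(n-1)\oplus 1=1$. A seed is an $(n-1)$-tuple $\psi=(a_1,\dots,a_{n-1})$ of distinct elements of $\{1,\dots,n\}$ with $a_1=n$ and $a_2\oplus1\notin\{a_1,\dots,a_{n-1}\}$; its missing element is $mis(\psi)=a_2\oplus 1$. The package $perms(\psi)$ is the set of all $n$-permutations obtained from $\psi$ by inserting $mis(\psi)$ at any position and then applying any cyclic rotation. Let $\pi_0=(n,n-1,\dots,1)$. For a seed $\psi$ with $x=mis(\psi)$ let $E(\psi)$ consist of a $\tau$-edge $\pi\to\tau(\pi)$ for every $\pi\in perms(\psi)$ whose second entry is $x$, and a $\sigma$-edge $\pi\to\sigma(\pi)$ for every $\pi\in perms(\psi)$ whose second entry is not $x$. Let $P$ be the union of $E(\psi)$ over all seeds; delete from $P$ every $\sigma$-edge leaving a vertex that has an outgoing $\tau$-edge in $P$; then add the $\sigma$-edge $\pi_0\to\sigma(\pi_0)$ and delete the $\tau$-edges $\pi_0\to\tau(\pi_0)$ and $\tau(\sigma(\pi_0))\to\sigma(\pi_0)$.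 The result $PATH(n)$ is a Hamiltonian path on all $n!$ $n$-permutations (the Sawada–Williams $\sigma\tau$-generation) starting at $\tau(\pi_0)$; $rank(\pi)$ is the number of edges of $PATH(n)$ from its start to $\pi$. Complexity is measured in a unit-cost RAM model where arithmetic operations on the integers involved take constant time. *)

theory Defs
  imports Complex_Main
begin

definition is_nperm :: "nat \<Rightarrow> nat list \<Rightarrow> bool" where
  "is_nperm n \<pi> \<longleftrightarrow> distinct \<pi> \<and> set \<pi> = {1..n}"

definition sig :: "nat list \<Rightarrow> nat list" where
  "sig \<pi> = rotate1 \<pi>"

definition tau :: "nat list \<Rightarrow> nat list" where
  "tau \<pi> = (case \<pi> of a # b # r \<Rightarrow> b # a # r | _ \<Rightarrow> \<pi>)"

definition oplus1 :: "nat \<Rightarrow> nat \<Rightarrow> nat" where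
  "oplus1 n a = (if a < n - 1 then a + 1 else 1)"

text \<open>Seeds (lists indexed from 0, so a_1 = psi!0, a_2 = psi!1).\<close>
definition is_seed :: "nat \<Rightarrow> nat list \<Rightarrow> bool" where
  "is_seed n \<psi> \<longleftrightarrow> length \<psi> = n - 1 \<and> distinct \<psi> \<and> set \<psi> \<subseteq> {1..n}
     \<and> \<psi> ! 0 = n \<and> oplus1 n (\<psi> ! 1) \<notin> set \<psi>"

definition mis :: "nat \<Rightarrow> nat list \<Rightarrow> nat" where
  "mis n \<psi> = oplus1 n (\<psi> ! 1)"

definition perms :: "nat \<Rightarrow> nat list \<Rightarrow> nat list set" where
  "perms n \<psi> = {rotate k (take i \<psi> @ mis n \<psi> # drop i \<psi>) | i k. i \<le> length \<psi>}"

definition tau_edges :: "nat \<Rightarrow> (nat list \<times> nat list) set" where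
  "tau_edges n = {(\<pi>, tau \<pi>) | \<pi> \<psi>. is_seed n \<psi> \<and> \<pi> \<in> perms n \<psi> \<and> \<pi> ! 1 = mis n \<psi>}"

definition sigma_edges :: "nat \<Rightarrow> (nat list \<times> nat list) set" where
  "sigma_edges n = {(\<pi>, sig \<pi>) | \<pi> \<psi>. is_seed n \<psi> \<and> \<pi> \<in> perms n \<psi> \<and> \<pi> ! 1 \<noteq> mis n \<psi>}"

definition pi0 :: "nat \<Rightarrow> nat list" where
  "pi0 n = rev [1..<n+1]"

definition path_edges :: "nat \<Rightarrow> (nat list \<times> nat list) set" where
  "path_edges n =
     {e \<in> sigma_edges n. \<not> (\<exists>\<rho>. (fst e, \<rho>) \<in> tau_edges n)}
     \<union> {(pi0 n, sig (pi0 n))}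
     \<union> (tau_edges n - {(pi0 n, tau (pi0 n)), (tau (sig (pi0 n)), sig (pi0 n))})"

definition rank :: "nat \<Rightarrow> nat list \<Rightarrow> nat" where
  "rank n \<pi> = (LEAST k. (tau (pi0 n), \<pi>) \<in> (path_edges n) ^^ k)"

text \<open>Registers indexed by naturals, holding (unbounded) integers; every
  instruction costs one step. Indirect addressing uses nat of the register value.\<close>
datatype instr =
    LoadC nat int
  | Add nat nat nat
  | Sub nat nat nat
  | Mul nat nat nat
  | Div nat nat nat            (* floor division, x div 0 = 0 *)
  | Mod nat nat nat
  | BAnd nat nat nat
  | BOr nat nat nat
  | BXor nat nat nat
  | LoadI nat nat
  | StoreI nat nat
  | Jle0 nat nat
  | Jmp nat

type_synonym config = "nat \<times> (nat \<Rightarrow> int)"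

fun exec :: "instr \<Rightarrow> config \<Rightarrow> config" where
  "exec (LoadC i c) (pc, m) = (pc + 1, m(i := c))"
| "exec (Add i j k) (pc, m) = (pc + 1, m(i := m j + m k))"
| "exec (Sub i j k) (pc, m) = (pc + 1, m(i := m j - m k))"
| "exec (Mul i j k) (pc, m) = (pc + 1, m(i := m j * m k))"
| "exec (Div i j k) (pc, m) = (pc + 1, m(i := m j div m k))"
| "exec (Mod i j k) (pc, m) = (pc + 1, m(i := m j mod m k))"
| "exec (BAnd i j k) (pc, m) = (pc + 1, m(i := and (m j) (m k)))"
| "exec (BOr i j k) (pc, m) = (pc + 1, m(i := or (m j) (m k)))"
| "exec (BXor i j k) (pc, m) = (pc + 1, m(i := xor (m j) (m k)))"
| "exec (LoadI i j) (pc, m) = (pc + 1, m(i := m (nat (m j))))"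
| "exec (StoreI i j) (pc, m) = (pc + 1, m(nat (m i) := m j))"
| "exec (Jle0 i l) (pc, m) = (if m i \<le> 0 then l else pc + 1, m)"
| "exec (Jmp l) (pc, m) = (l, m)"

definition step :: "instr list \<Rightarrow> config \<Rightarrow> config" where
  "step prog c = (if fst c < length prog then exec (prog ! fst c) c else c)"

definition halted :: "instr list \<Rightarrow> config \<Rightarrow> bool" where
  "halted prog c \<longleftrightarrow> length prog \<le> fst c"

text \<open>Input: r[0] = n, r[1..n] = a_1..a_n, all other registers 0. Output: r[0].\<close>
definition init_config :: "nat list \<Rightarrow> config" where
  "init_config \<pi> = (0, \<lambda>a. if a = 0 then int (length \<pi>)
                           else if a \<le> length \<pi> then int (\<pi> ! (a - 1)) else 0)"

end

theory Submission
  imports Defs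
begin

text \<open>
  Let \<open>N = n - 1\<close>. Cutting at \<open>n\<close>, a permutation is a list \<open>L\<close> over
  \<open>{1..N}\<close>, read cyclically after \<open>n\<close>, together with the number \<open>c\<close> of entries
  after \<open>n\<close>. Assign \<open>L\<close> to the seed \<open>\<psi>\<close> obtained by
  deleting the successor \<open>x\<close> of the head of \<open>L\<close>; moving \<open>x\<close> to the front of \<open>L\<close> gives the list
  that \<open>\<psi>\<close> shares with its parent seed. With the edge leaving \<open>\<pi>\<^sub>0\<close> exchanged, the
  seeds form a tree and the path is its Euler tour. The size of a subtree only depends on the length of the
  initial run of consecutive decreasing entries of the seed, except for the seeds on the
  spine, where the run is complete. Hence the rank has a recursive
  expression along the parents of \<open>L\<close> (iterated move-to-front). It is justified locally: the expression
  increases by one along each edge, vanishes at the start, and every other permutation has a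
  predecessor.

  The recursion needs for each \<open>s\<close> the position of the next entry to be moved after \<open>s\<close>
  moves, i.e. its position in \<open>L\<close> plus the number of moved entries that were behind it. A
  register may hold a number as large as \<open>n ^ n\<close>, so the set of moved positions is
  kept as \<open>\<Sum>n ^ j\<close>; a division by a power of \<open>n\<close> followed by a reduction modulo
  \<open>n - 1\<close> (a digit sum) counts the positions behind a given one in constant time. The
  whole computation takes linear time.
\<close>

section \<open>Lists up to rotation and the recursive rank formula\<close>

text \<open>The \<open>N\<close> seeds whose run is complete form a cycle under the parent map; the
  edges exchanged at \<open>pi0\<close> cut it at the class of \<open>desc N\<close>. The path
  therefore begins at the top of the spine, runs straight down with two vertices per spine class,
  turns at \<open>pi0 (Suc N)\<close> and has visited \<open>2 * N\<close> vertices when it reaches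
  \<open>sig (pi0 (Suc N))\<close>. On the way back the rest is collected. Each spine seed, with its
  subtrees off the spine, accounts for the same number \<open>M_num N\<close> = n!/(n-1) of
  vertices, as the cyclic symmetry of \<open>nx\<close> suggests; this is the origin of the terms
  \<open>2 * N\<close> and \<open>M_num N - 2\<close>. Counting the moved entries behind a position
  is a task of the type of inversion counting, the usual source of a factor sqrt(log n); wide
  registers answer each query in constant time. The price is a bound on their contents: every
  intermediate configuration must stay below a fixed power of n!, and numbers of size n^n are
  admissible because n^n \<le> (n!)^2.\<close>

definition nx :: "nat \<Rightarrow> nat \<Rightarrow> nat" where
  "nx N a = oplus1 (Suc N) a"

lemma nx_mod: "1 \<le> a \<Longrightarrow> a \<le> N \<Longrightarrow> nx N a = a mod N + 1"
  by (auto simp: nx_def oplus1_def)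

lemma nx_range: "1 \<le> N \<Longrightarrow> 1 \<le> nx N a \<and> nx N a \<le> N"
  by (auto simp: nx_def oplus1_def)

lemma nx_neq: "2 \<le> N \<Longrightarrow> nx N a \<noteq> a"
  by (auto simp: nx_def oplus1_def split: if_splits)

lemma is_nperm_length: "is_nperm n L \<Longrightarrow> length L = n"
  by (metis card_atLeastAtMost diff_Suc_1 distinct_card is_nperm_def)

section \<open>Cyclically decreasing runs and the effect of an insertion\<close>

fun run :: "nat \<Rightarrow> nat list \<Rightarrow> nat" where
  "run N [] = 0"
| "run N [a] = 1"
| "run N (a # b # l) = (if a = nx N b then Suc (run N (b # l)) else 1)"

lemma run_le: "run N L \<le> length L"
  by (induction N L rule: run.induct) auto

lemma run_pos: "L \<noteq> [] \<Longrightarrow> 1 \<le> run N L"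
  by (induction N L rule: run.induct) auto

lemma run_break:
  "A \<noteq> [] \<Longrightarrow> last A \<noteq> nx N x \<Longrightarrow> run N (A @ x # B) = min (length A) (run N (A @ B))"
proof (induction N A rule: run.induct)
  case (2 N a)
  have "1 \<le> run N (a # B)" by (rule run_pos) simp
  with 2 show ?case by simp
qed auto

lemma run_short: "run N A < length A \<Longrightarrow> run N (A @ C) = run N A"
  by (induction N A rule: run.induct) auto

lemma run_nth:
  "Suc i < run N L \<Longrightarrow> L ! i = nx N (L ! Suc i)"
proof (induction N L arbitrary: i rule: run.induct)
  case (3 N a b l)
  then show ?case by (cases i) (auto split: if_splits)
qed auto

lemma chain_cong:
  assumes "run N A = length A" "A \<noteq> []" "set A \<subseteq> {1..N}"
  shows "hd A mod N = (last A + (length A - 1)) mod N"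
  using assms
proof (induction N A rule: run.induct)
  case (3 N a b l)
  then have ab: "a = nx N b" by (auto split: if_splits)
  with 3 have IH: "b mod N = (last (b # l) + (length (b # l) - 1)) mod N" by auto
  have "a = b mod N + 1" using ab 3 nx_mod[of b N] by auto
  then have "a mod N = (b + 1) mod N" by (metis mod_add_left_eq)
  also have "\<dots> = (b mod N + 1) mod N" by (metis mod_add_left_eq)
  also have "\<dots> = (last (b # l) + length (b # l)) mod N" by (simp only: IH) (simp add: mod_Suc_eq)
  finally show ?case by simp
qed auto

text \<open>If the run ends inside \<open>A\<close>, the insertion is invisible. Otherwise it cuts
  the run behind \<open>A\<close>, unless \<open>last A\<close> is again the successor of
  \<open>x\<close>; then \<open>A @ [x]\<close> is a whole residue system and \<open>B\<close> is
  empty. This exception is the spine.\<close>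

lemma run_insert:
  assumes P: "is_nperm N (A @ x # B)" and A: "A \<noteq> []" and x: "x = nx N (hd A)" and N: "3 \<le> N"
  shows "run N (A @ x # B)
    = (if run N (A @ B) = N - 1 \<and> length A = N - 1 then N else min (length A) (run N (A @ B)))"
proof -
  have len: "length A + Suc (length B) = N" using is_nperm_length[OF P] by simp
  have sA: "set A \<subseteq> {1..N}" using P by (auto simp: is_nperm_def)
  have xr: "1 \<le> x" "x \<le> N" using P by (auto simp: is_nperm_def)
  have hA: "hd A \<in> {1..N}" "last A \<in> {1..N}" using sA A by (auto dest: hd_in_set last_in_set)
  have x': "x = hd A mod N + 1" using x hA nx_mod by simp
  show ?thesis
  proof (cases "run N A < length A")
    case True
    have "run N A < N - 1" using True len by simp
    with True run_short[OF True] show ?thesis by auto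
  next
    case False
    then have full: "run N A = length A" using run_le[of N A] by simp
    have c: "hd A mod N = (last A + (length A - 1)) mod N" using chain_cong[OF full A sA] .
    show ?thesis
    proof (cases "last A = nx N x")
      case True
      then have "last A = x mod N + 1" using xr nx_mod by simp
      \<comment> \<open>Going down from \<open>hd A\<close> to \<open>last A\<close>, then to
        \<open>x\<close> and back to \<open>hd A\<close> is a closed walk on the residues, so its
        length \<open>length A + 1\<close> is a multiple of \<open>N\<close>.\<close>
      then have "last A mod N = (x + 1) mod N" by (metis mod_add_left_eq)
      also have "\<dots> = (hd A + 2) mod N" by (simp add: x' ) (metis mod_Suc_eq mod_Suc_Suc_eq)
      also have "\<dots> = (last A + (length A - 1) + 2) mod N" by (metis c mod_add_left_eq)
      also have "last A + (length A - 1) + 2 = last A + (length A + 1)" using A by (cases A) auto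
      finally have "N dvd length A + 1"
        by (metis add_diff_cancel_left' mod_eq_dvd_iff_nat le_add1)
      then have "N \<le> length A + 1" by (auto dest: dvd_imp_le)
      then have lA: "length A = N - 1" "B = []" using len by auto
      have "run N (A @ [x]) = N"
      proof -
        have gen: "run N (A' @ [y]) = Suc (length A')"
          if "run N A' = length A'" "A' \<noteq> []" "last A' = nx N y" for A' y
          using that by (induction N A' rule: run.induct) (auto split: if_splits)
        show ?thesis using gen[OF full A True] lA N by simp
      qed
      then show ?thesis using lA full by simp
    next
      case last: False
      have "\<not> (run N (A @ B) = N - 1 \<and> length A = N - 1)"
      proof
        assume a: "run N (A @ B) = N - 1 \<and> length A = N - 1"
        have "(hd A + 2) mod N = (last A + (length A - 1) + 2) mod N" by (metis c mod_add_left_eq)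
        also have "last A + (length A - 1) + 2 = last A + N" using a N by simp
        finally have "(hd A + 2) mod N = last A mod N" by simp
        moreover have "nx N x mod N = (hd A + 2) mod N"
          using nx_mod[OF xr] by (simp add: x') (metis mod_Suc_eq mod_Suc_Suc_eq)
        ultimately have "nx N x mod N = last A mod N" by simp
        moreover have "nx N x \<in> {1..N}" using nx_range N by simp
        ultimately have "nx N x = last A" using hA
          by (metis atLeastAtMost_iff le_neq_implies_less mod_less mod_self not_one_le_zero)
        with last show False by simp
      qed
      then show ?thesis using run_break[OF A last, of B] by auto
    qed
  qed
qed

section \<open>The parent of a list and the position of the moved entry\<close>

definition up :: "nat \<Rightarrow> nat list \<Rightarrow> nat list" where
  "up N L = nx N (hd L) # remove1 (nx N (hd L)) L"

definition ipos :: "'a \<Rightarrow> 'a list \<Rightarrow> nat" where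
  "ipos v L = length (takeWhile (\<lambda>y. y \<noteq> v) L)"

lemma ipos_append: "v \<notin> set A \<Longrightarrow> ipos v (A @ v # B) = length A"
  unfolding ipos_def by (metis (mono_tags, lifting) takeWhile_append2 append_Nil2 takeWhile.simps(2))

definition jpos :: "nat \<Rightarrow> nat list \<Rightarrow> nat" where
  "jpos N L = ipos (nx N (hd L)) L"

lemma nperm_split:
  assumes P: "is_nperm N L" and N: "3 \<le> N"
  obtains A B where "L = A @ nx N (hd A) # B" "A \<noteq> []" "hd A = hd L"
proof -
  have L: "L \<noteq> []" using is_nperm_length[OF P] N by auto
  have "nx N (hd L) \<in> set L" using P nx_range[of N "hd L"] N by (auto simp: is_nperm_def)
  then obtain A B where AB: "L = A @ nx N (hd L) # B" by (meson split_list)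
  have "A \<noteq> []" using AB nx_neq[of N "hd L"] N by (metis append_Nil list.sel(1) One_nat_def Suc_leD numeral_2_eq_2 numeral_3_eq_3)
  then have "hd A = hd L" using AB by (metis hd_append2)
  with AB \<open>A \<noteq> []\<close> that show thesis by metis
qed

lemma split_facts:
  assumes P: "is_nperm N (A @ x # B)" and A: "A \<noteq> []" and x: "x = nx N (hd A)"
  shows "up N (A @ x # B) = x # A @ B" "jpos N (A @ x # B) = length A"
    "is_nperm N (x # A @ B)" "length A + Suc (length B) = N"
proof -
  have h: "hd (A @ x # B) = hd A" using A by simp
  have xA: "x \<notin> set A" using P by (auto simp: is_nperm_def)
  show "up N (A @ x # B) = x # A @ B" unfolding up_def h x[symmetric] using xA by (simp add: remove1_append)
  show "jpos N (A @ x # B) = length A" unfolding jpos_def h x[symmetric] by (rule ipos_append[OF xA])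
  show "is_nperm N (x # A @ B)" using P by (auto simp: is_nperm_def)
  show "length A + Suc (length B) = N" using is_nperm_length[OF P] by simp
qed

lemma run_up_split:
  assumes "A \<noteq> []" and "x = nx N (hd A)"
  shows "run N (x # A @ B) = Suc (run N (A @ B))"
  using assms by (cases A) auto

lemma up_nperm: "is_nperm N L \<Longrightarrow> 3 \<le> N \<Longrightarrow> is_nperm N (up N L)"
  by (metis nperm_split split_facts(1,3))

lemma jpos_bounds:
  assumes P: "is_nperm N L" and N: "3 \<le> N"
  shows "1 \<le> jpos N L" "jpos N L \<le> N - 1"
proof -
  obtain A B where AB: "L = A @ nx N (hd A) # B" "A \<noteq> []" "hd A = hd L" using nperm_split[OF P N] .
  have "jpos N L = length A" "length A + Suc (length B) = N"
    using split_facts(2,4)[OF P[unfolded AB(1)] AB(2) refl] AB(1) by auto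
  moreover have "1 \<le> length A" using AB(2) by (cases A) auto
  ultimately show "1 \<le> jpos N L" "jpos N L \<le> N - 1" by auto
qed

text \<open>The run of the parent exceeds that of \<open>A @ B\<close> by one, so
  \<open>run_insert\<close> applies. All runs along the chain of parents thus follow from the
  positions alone, starting at the spine.\<close>

lemma run_rec:
  assumes P: "is_nperm N L" and N: "3 \<le> N"
  shows "run N L = (if run N (up N L) = N \<and> jpos N L = N - 1 then N
                    else min (jpos N L) (run N (up N L) - 1))"
proof -
  obtain A B where AB: "L = A @ nx N (hd A) # B" "A \<noteq> []" "hd A = hd L" using nperm_split[OF P N] .
  note sf = split_facts[OF P[unfolded AB(1)] AB(2) refl]
  show ?thesis
    using run_insert[OF P[unfolded AB(1)] AB(2) refl N] run_up_split[OF AB(2) refl, of N B] N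
    unfolding AB(1) sf(1) sf(2) by auto
qed

lemma run_le_N: "is_nperm N L \<Longrightarrow> run N L \<le> N"
  using run_le[of N L] is_nperm_length by simp

text \<open>Runs grow strictly towards the spine; for permutations the guard in \<open>Y_num\<close>
  therefore never takes effect, and the recursion has depth below \<open>N\<close>.\<close>

lemma run_up_less: 
  assumes P: "is_nperm N L" and N: "3 \<le> N" and "run N L < N"
  shows "run N L < run N (up N L)"
proof -
  have "up N L \<noteq> []" by (simp add: up_def)
  then have "1 \<le> run N (up N L)" by (rule run_pos)
  with run_rec[OF P N] assms(3) show ?thesis by (auto split: if_splits)
qed

lemma up_run_ge2: 
  assumes P: "is_nperm N L" and N: "3 \<le> N"
  shows "2 \<le> run N (up N L)"
proof -
  obtain A B where AB: "L = A @ nx N (hd A) # B" "A \<noteq> []" "hd A = hd L" using nperm_split[OF P N] .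
  have "1 \<le> run N (A @ B)" using AB(2) by (intro run_pos) simp
  then show ?thesis
    using split_facts(1)[OF P[unfolded AB(1)] AB(2) refl] run_up_split[OF AB(2) refl, of N B] AB(1) by simp
qed

lemma hd_up: "hd (up N L) = nx N (hd L)" by (simp add: up_def)

text \<open>\<open>T_num N k\<close> is the number of permutations visited in the subtree of a seed off the spine
  whose initial run has length \<open>k\<close>, where each seed contributes \<open>n(n - 2)\<close> of them and has
  \<open>n - 3\<close> children, with runs \<open>1, \<dots>, k - 1, k - 1, \<dots>\<close>, unless \<open>k = 1\<close>.\<close>
fun e_num :: "nat \<Rightarrow> nat \<Rightarrow> int" where
  "e_num N 0 = int N + 1"
| "e_num N (Suc i) = (int N - 1 - int i) * e_num N i"

fun T_num :: "nat \<Rightarrow> nat \<Rightarrow> int" where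
  "T_num N 0 = 0"
| "T_num N (Suc k) = T_num N k + e_num N (Suc k)"

text \<open>Total size of the subtrees of \<open>k\<close> children, one for each run length from 1
  to \<open>k\<close>.\<close>

fun U_num :: "nat \<Rightarrow> nat \<Rightarrow> int" where
  "U_num N 0 = 0"
| "U_num N (Suc k) = U_num N k + T_num N (Suc k)"

text \<open>With n = \<open>Suc N\<close> this is n (n-2)! = n!/(n-1), the share of one spine seed
  and its subtrees off the spine.\<close>

definition M_num :: "nat \<Rightarrow> int" where
  "M_num N = e_num N (N - 1)"

text \<open>The size equation of a seed with run \<open>Suc k\<close>: its own vertices, one child
  for each run up to \<open>k\<close>, and \<open>N - 2 - k\<close> further children with run
  \<open>k\<close>. Subtracting the equations for consecutive runs cancels the sums and leaves the
  factor \<open>N - 1 - k\<close>, which explains the recursion of \<open>e_num\<close>.\<close>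

lemma T_subtree:
  "T_num N (Suc k) = (int N + 1) * (int N - 1) + U_num N k + (int N - 2 - int k) * T_num N k"
proof (induction k)
  case (Suc k)
  have "T_num N (Suc (Suc k)) = T_num N (Suc k) + (int N - 2 - int k) * (T_num N (Suc k) - T_num N k)"
    by (simp add: algebra_simps)
  with Suc show ?case by (simp add: algebra_simps)
qed (simp add: algebra_simps)

lemma M_num_eq: "2 \<le> N \<Longrightarrow> M_num N = T_num N (N - 1) - T_num N (N - 2)"
proof -
  assume "2 \<le> N"
  then have "Suc (N - 2) = N - 1" by simp
  then show "M_num N = T_num N (N - 1) - T_num N (N - 2)"
    using T_num.simps(2)[of N "N - 2"] by (simp add: M_num_def)
qed

declare e_num.simps(2) [simp del] T_num.simps(2) [simp del] U_num.simps(2) [simp del]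

lemma T_num_last:
  assumes "2 \<le> N"
  shows "T_num N (N - 1) = (int N + 1) * (int N - 1) + U_num N (N - 2)"
proof -
  have "Suc (N - 2) = N - 1" "int (N - 2) = int N - 2" using assms by auto
  then show ?thesis using T_subtree[of N "N - 2"] by simp
qed

text \<open>The children of a spine seed off the spine have runs 1 to \<open>N - 3\<close>; the one
  remaining child continues the spine.\<close>

lemma M_num_U: 
  assumes "3 \<le> N" 
  shows "M_num N = (int N + 1) * (int N - 1) + U_num N (N - 3)"
proof -
  have "Suc (N - 3) = N - 2" using assms by simp
  then show ?thesis using M_num_eq[of N] T_num_last[of N] U_num.simps(2)[of N "N - 3"] assms by simp
qed

text \<open>The value of a permutation in which \<open>n = Suc N\<close> is last; this is where the visit of the
  subtree below the class \<open>L\<close> ends. The guard on \<open>run\<close> only serves termination.\<close>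
function Y_num :: "nat \<Rightarrow> nat list \<Rightarrow> int" where
  "Y_num N L = (if N \<le> run N L then 2 * int N + int (hd L mod N) * (M_num N - 2)
    else if run N (up N L) \<le> run N L then 0
    else (if N \<le> run N (up N L) then 2 * int N + (int (hd L mod N) + 1) * (M_num N - 2) else Y_num N (up N L))
       - U_num N (run N L - 1) - (int (jpos N L) - int (run N L) - 1) * T_num N (run N L - 1)
       - (int N + 2) * int (jpos N L) + (int N + 1))"
  by pat_completeness auto
termination by (relation "measure (\<lambda>(N, L). N - run N L)") auto

declare Y_num.simps [simp del]

text \<open>For permutations this differs from \<open>Y_num N (up N L)\<close> only if the parent is
  \<open>desc N\<close>. Then the factor of \<open>M_num N - 2\<close> is \<open>N\<close> instead
  of 0 and the value is n!, one past the end of the path, as if the cut spine were closed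
  again.\<close>

definition Yo_num :: "nat \<Rightarrow> nat list \<Rightarrow> int" where
  "Yo_num N L = (if run N (up N L) = N then 2 * int N + (int (hd L mod N) + 1) * (M_num N - 2)
                 else Y_num N (up N L))"

text \<open>The size of the subtree attached to \<open>L\<close>, which is visited after \<open>n # L\<close>.\<close>
definition Z_num :: "nat \<Rightarrow> nat list \<Rightarrow> int" where
  "Z_num N L = (if run N L = N then int (hd L mod N) * M_num N else T_num N (run N L - 1))"

text \<open>On the spine \<open>hd L mod N\<close> counts the classes strictly below
  \<open>L\<close>, down to \<open>desc N\<close>, whose value is \<open>2 * N\<close>.\<close>

lemma Y_full: "run N L = N \<Longrightarrow> Y_num N L = 2 * int N + int (hd L mod N) * (M_num N - 2)"
  by (subst Y_num.simps) simp

text \<open>Moving \<open>x\<close> one place to the left leads to the next sibling, whose value is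
  higher by \<open>N + 2\<close> plus the size of its subtree. Summing the sizes over the positions
  below \<open>jpos\<close> gives the terms with \<open>U_num\<close> and \<open>T_num\<close>; the
  last move enters the parent and adds 1. On the spine the same formula holds with
  \<open>r = N - 1\<close>.\<close>

lemma Y_rec:
  assumes P: "is_nperm N L" and N: "3 \<le> N" 
    and r: "r = min (jpos N L) (run N (up N L) - 1)"
  shows "Y_num N L = Yo_num N L - U_num N (r - 1) - (int (jpos N L) - int r - 1) * T_num N (r - 1)
       - (int N + 2) * int (jpos N L) + (int N + 1)"
proof (cases "run N L = N")
  case True
  have u: "run N (up N L) = N" "jpos N L = N - 1"
  proof -
    have "min (jpos N L) (run N (up N L) - 1) < N" using jpos_bounds[OF P N] N by linarith
    then show "run N (up N L) = N" "jpos N L = N - 1" using run_rec[OF P N] True by (auto split: if_splits)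
  qed
  have rr: "r = N - 1" using r u by simp
  have iN: "int (N - 1) = int N - 1" "N - 1 - 1 = N - 2" using N by auto
  have "T_num N (N - 2) = T_num N (N - 1) - M_num N" "U_num N (N - 2) = T_num N (N - 1) - (int N + 1) * (int N - 1)"
    using M_num_eq[of N] T_num_last[of N] N by simp_all
  then show ?thesis
    unfolding Y_full[OF True] Yo_num_def rr u(2) if_P[OF u(1)] iN by (simp add: algebra_simps)
next
  case False
  then have lt: "run N L < N" using run_le_N[OF P] by simp
  have rr: "r = run N L" using run_rec[OF P N] r False by auto
  have up: "run N L < run N (up N L)" using run_up_less[OF P N lt] .
  have leN: "run N (up N L) \<le> N" using run_le_N[OF up_nperm[OF P N]] .
  have "N \<le> run N (up N L) \<longleftrightarrow> run N (up N L) = N" using leN by auto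
  moreover have "\<not> N \<le> run N L" "\<not> run N (up N L) \<le> run N L" using up lt by auto
  ultimately show ?thesis unfolding Yo_num_def rr using Y_num.simps[of N L] by simp
qed

definition mk :: "nat list \<Rightarrow> nat \<Rightarrow> nat list" where
  "mk L c = drop c L @ Suc (length L) # take c L"

text \<open>The tour enters a class at \<open>c = jpos N L\<close>, rotates up to
  \<open>c = N\<close>, makes the detour of \<open>Z_num N L\<close> vertices, returns at
  \<open>c = 0\<close> and leaves at \<open>c = jpos N L - 1\<close>. Rotations with
  \<open>c\<close> at least \<open>jpos N L\<close> precede the detour, hence the
  correction.\<close>

definition val :: "nat \<Rightarrow> nat list \<Rightarrow> nat \<Rightarrow> int" where
  "val N L c = Y_num N L + int c - (if jpos N L \<le> c then int N + 1 + Z_num N L else 0)"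

section \<open>The formula along the edges of the path\<close>

definition desc :: "nat \<Rightarrow> nat list" where
  "desc N = rev [1..<Suc N]"

lemma desc_nperm: "is_nperm N (desc N)"
  by (auto simp: desc_def is_nperm_def)

lemma run_desc: "1 \<le> N \<Longrightarrow> run N (desc N) = N"
proof -
  have "run N (rev [1..<Suc k]) = k" if "k \<le> N" for k
    using that
  proof (induction k)
    case (Suc k)
    then show ?case
    proof (cases k)
      case (Suc j)
      have "nx N (Suc j) = Suc (Suc j)" using Suc Suc.prems by (simp add: nx_def oplus1_def)
      with Suc.IH Suc.prems Suc show ?thesis by simp
    qed simp
  qed simp
  then show ?thesis by (simp add: desc_def)
qed

lemma run_full_desc:
  assumes P: "is_nperm N L" and N: "1 \<le> N" and r: "run N L = N" and h: "hd L = N"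
  shows "L = desc N"
proof (rule nth_equalityI)
  have len: "length L = N" using is_nperm_length[OF P] .
  then show "length L = length (desc N)" by (simp add: desc_def)
  have nth: "L ! i = N - i" if "i < N" for i
    using that
  proof (induction i)
    case 0
    then show ?case using h len by (cases L) auto
  next
    case (Suc i)
    have "nx N (L ! Suc i) = N - i" using run_nth[of i N L] r Suc by simp
    moreover have "L ! Suc i \<in> {1..N}" using P Suc.prems len nth_mem unfolding is_nperm_def by blast
    ultimately show ?case using Suc.prems by (simp add: nx_def oplus1_def split: if_splits)
  qed
  fix i assume "i < length L"
  then show "L ! i = desc N ! i" using nth[of i] len by (simp add: desc_def rev_nth del: upt_Suc)
qed

lemma pi0_mk: "pi0 (Suc N) = mk (desc N) N"
  by (simp add: pi0_def mk_def desc_def)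

lemma mk_nperm: "is_nperm N L \<Longrightarrow> c \<le> N \<Longrightarrow> is_nperm (Suc N) (mk L c)"
proof -
  assume P: "is_nperm N L" and c: "c \<le> N"
  have "set (drop c L) \<union> set (take c L) = set L" by (metis append_take_drop_id set_append sup_commute)
  moreover have "set (take c L) \<inter> set (drop c L) = {}"
    using P by (intro set_take_disj_set_drop_if_distinct) (auto simp: is_nperm_def)
  ultimately show ?thesis using P is_nperm_length[OF P]
    unfolding is_nperm_def mk_def by (auto simp: atLeastAtMostSuc_conv dest: in_set_takeD in_set_dropD)
qed

lemma mk_surj:
  assumes P: "is_nperm (Suc N) \<pi>"
  obtains L c where "is_nperm N L" "c \<le> N" "\<pi> = mk L c"
proof -
  have "Suc N \<in> set \<pi>" using P by (auto simp: is_nperm_def)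
  then obtain A B where AB: "\<pi> = A @ Suc N # B" by (meson split_list)
  have d: "distinct (A @ Suc N # B)" "set (A @ Suc N # B) = {1..Suc N}" using P AB by (auto simp: is_nperm_def)
  have "set (B @ A) = {1..Suc N} - {Suc N}" using d by auto
  also have "\<dots> = {1..N}" by auto
  finally have Q: "is_nperm N (B @ A)" using d by (auto simp: is_nperm_def)
  then have "length (B @ A) = N" by (rule is_nperm_length)
  then have "\<pi> = mk (B @ A) (length B)" "length B \<le> N" by (auto simp: mk_def AB)
  with Q that show thesis by blast
qed

lemma sig_mk: "c < length L \<Longrightarrow> sig (mk L c) = mk L (Suc c)"
  by (simp add: sig_def mk_def take_Suc_conv_app_nth Cons_nth_drop_Suc[symmetric])

lemma sig_mk_last: "sig (mk L (length L)) = mk L 0"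
  by (simp add: sig_def mk_def)

lemma tau_tau: "tau (tau \<pi>) = \<pi>"
  by (auto simp: tau_def split: list.splits)

lemma tau_mk_swap: "tau (mk (A @ y # x # B) (length A)) = mk (A @ x # y # B) (length A)"
  by (simp add: mk_def tau_def)

lemma tau_mk_front: "tau (mk (b # C) (Suc (length C))) = mk (C @ [b]) (length C)"
  by (simp add: mk_def tau_def)

lemma val_sigma: "jpos N L \<noteq> Suc c \<Longrightarrow> val N L (Suc c) = val N L c + 1"
  by (auto simp: val_def)

text \<open>A sigma-edge from \<open>c = N\<close> to \<open>c = 0\<close> skips the detour, so
  there must be no subtree: the run is 1, or the list is \<open>desc N\<close>, below which the
  spine is cut.\<close>

lemma val_wrap:
  assumes P: "is_nperm N L" and N: "3 \<le> N" and L: "L ! 0 \<noteq> nx N (L ! 1) \<or> L = desc N"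
  shows "val N L 0 = val N L N + 1"
proof -
  have "Z_num N L = 0"
  proof (cases "L = desc N")
    case True
    have "hd L = N" using N unfolding True by (simp add: desc_def)
    then show ?thesis using run_desc[of N] N True by (simp add: Z_num_def)
  next
    case False
    then have "L ! 0 \<noteq> nx N (L ! 1)" using L by simp
    then have "run N L \<le> 1" using run_nth[of 0 N L] by force
    moreover have "run N L \<ge> 1" using is_nperm_length[OF P] N by (intro run_pos) auto
    ultimately show ?thesis using N by (simp add: Z_num_def)
  qed
  then show ?thesis using jpos_bounds[OF P N] N by (simp add: val_def)
qed

text \<open>The edge moves \<open>x\<close> one place to the left inside its package. For nonempty
  \<open>A\<close> it arrives at the entry point of the next sibling, for empty \<open>A\<close> at
  the return point \<open>c = 0\<close> of the parent. The excluded case is the deleted edge into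
  \<open>sig (pi0 (Suc N))\<close>, where the value would fall from the end of the path to
  \<open>2 * N\<close>.\<close>

lemma val_tau_own:
  assumes P: "is_nperm N (A @ y # x # B)" and x: "x = nx N (hd (A @ [y]))" and N: "3 \<le> N"
    and ex: "\<not> (A = [] \<and> A @ x # y # B = desc N)"
  shows "val N (A @ x # y # B) (length A) = val N (A @ y # x # B) (length A) + 1"
proof -
  let ?L = "A @ y # x # B" and ?L' = "A @ x # y # B"
  have P1: "is_nperm N ((A @ [y]) @ x # B)" using P by simp
  note sf = split_facts[OF P1 _ x, simplified]
  have P': "is_nperm N ?L'" using P by (auto simp: is_nperm_def)
  have ge2: "2 \<le> run N (up N ?L)" using up_run_ge2[OF P N] .
  define r where "r = min (jpos N ?L) (run N (up N ?L) - 1)"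
  note Y1 = Y_rec[OF P N r_def]
  have valL: "val N ?L (length A) = Y_num N ?L + int (length A)" using sf(2) by (simp add: val_def)
  show ?thesis
  proof (cases "A = []")
    case True
    have upL: "up N ?L = ?L'" using sf(1) True by simp
    have r1: "r = 1" using ge2 sf(2) True by (simp add: r_def)
    have Yo: "Y_num N ?L = Yo_num N ?L - 1" using Y1 sf(2) True r1 by simp
    have "Yo_num N ?L = Y_num N ?L'"
    proof (cases "run N (up N ?L) = N")
      case full: True
      then have r: "run N ?L' = N" using upL by simp
      have x': "x = nx N y" using x True by simp
      have yr: "1 \<le> y" "y \<le> N" using P by (auto simp: is_nperm_def)
      \<comment> \<open>The residue of the head wraps around only at \<open>desc N\<close>;
        elsewhere on the spine it grows by one.\<close>
      have "x \<noteq> N" using run_full_desc[OF P' _ r] ex True N by auto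
      then have "int (x mod N) = int (y mod N) + 1" using yr N x'
        by (auto simp: nx_def oplus1_def split: if_splits)
      then show ?thesis using Y_full[OF r] full True by (simp add: Yo_num_def)
    qed (use upL in \<open>simp add: Yo_num_def\<close>)
    moreover have "val N ?L' 0 = Y_num N ?L'" using jpos_bounds[OF P' N] by (simp add: val_def)
    ultimately show ?thesis using valL Yo True by simp
  next
    case False
    have x': "x = nx N (hd A)" using x False by simp
    note sf' = split_facts[OF P' False x']
    have upe: "up N ?L' = up N ?L" using sf(1) sf'(1) by simp
    have Yoe: "Yo_num N ?L' = Yo_num N ?L" using upe False by (simp add: Yo_num_def)
    define r' where "r' = min (jpos N ?L') (run N (up N ?L') - 1)"
    note Y2 = Y_rec[OF P' N r'_def]
    have j: "jpos N ?L = Suc (length A)" "jpos N ?L' = length A" "length A \<le> N - 2"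
      using sf(2,4) sf'(2) by auto
    have rr: "run N ?L' = r'" "r' \<noteq> N" using run_rec[OF P' N] j N by (auto simp: r'_def)
    then have Z: "Z_num N ?L' = T_num N (r' - 1)" by (simp add: Z_num_def)
    have valL': "val N ?L' (length A) = Y_num N ?L' + int (length A) - (int N + 1 + Z_num N ?L')"
      using j by (simp add: val_def)
    have A1: "1 \<le> length A" using False by (cases A) auto
    show ?thesis
    proof (cases "Suc (length A) \<le> run N (up N ?L) - 1")
      case True
      then have "r = Suc (length A)" "r' = length A" by (auto simp: r_def r'_def j upe)
      moreover have "U_num N (length A) = U_num N (length A - 1) + T_num N (length A)"
      proof -
        have "Suc (length A - 1) = length A" using A1 by simp
        then show ?thesis using U_num.simps(2)[of N "length A - 1"] by (simp only:)
      qed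
      ultimately show ?thesis
        by (simp add: valL valL' Y1 Y2 Z j Yoe algebra_simps)
    next
      case F: False
      then have "r' = r" by (auto simp: r_def r'_def j upe)
      then show ?thesis by (simp add: valL valL' Y1 Y2 Z j Yoe algebra_simps)
    qed
  qed
qed

text \<open>The subtree is entered at the class in which \<open>b\<close> is last, that is, farthest
  from the front. Off the spine the claim amounts to the size equation \<open>T_subtree\<close>; on
  the spine every level costs two vertices on the way down. The excluded list belongs to the deleted
  tau-edge leaving \<open>pi0 (Suc N)\<close>.\<close>

lemma val_tau_child:
  assumes P: "is_nperm N (b # C)" and b: "b = nx N (hd C)" and N: "3 \<le> N" and ex: "b # C \<noteq> desc N"
  shows "val N (C @ [b]) (length C) = val N (b # C) N + 1"
proof -
  let ?L = "b # C" and ?L' = "C @ [b]"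
  have len: "Suc (length C) = N" using is_nperm_length[OF P] by simp
  then have C: "C \<noteq> []" using N by auto
  have P': "is_nperm N ?L'" using P by (auto simp: is_nperm_def)
  note sf = split_facts[OF P' C b, simplified]
  have j: "jpos N ?L' = N - 1" using sf(2) len by simp
  have val1: "val N ?L N = Y_num N ?L - 1 - Z_num N ?L"
  proof -
    have "jpos N ?L \<le> N" using jpos_bounds[OF P N] by linarith
    then show ?thesis by (simp add: val_def)
  qed
  have val2: "val N ?L' (length C) = Y_num N ?L' - 2 - Z_num N ?L'" using sf(2) len by (simp add: val_def)
  have hr: "hd C \<in> {1..N}" using P C by (auto simp: is_nperm_def)
  show ?thesis
  proof (cases "run N ?L = N")
    case True
    have r': "run N ?L' = N" using run_rec[OF P' N] True sf(1) j by simp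
    have "b \<noteq> N" using run_full_desc[OF P _ True] ex N by auto
    then have "int (b mod N) = int (hd C mod N) + 1"
      using hr N b by (auto simp: nx_def oplus1_def split: if_splits)
    then show ?thesis using C
      by (simp add: val1 val2 Y_full[OF True] Y_full[OF r'] Z_num_def True r' algebra_simps)
  next
    case False
    then have lt: "run N ?L < N" using run_le_N[OF P] by simp
    have ge2: "2 \<le> run N ?L" using up_run_ge2[OF P' N] sf(1) by simp
    define k where "k = run N ?L - 2"
    have k: "run N ?L = Suc (Suc k)" using ge2 by (simp add: k_def)
    have r': "Suc k = min (jpos N ?L') (run N (up N ?L') - 1)" using lt unfolding j sf(1) k by simp
    have rr: "run N ?L' = Suc k" using run_rec[OF P' N] r' False sf(1) by auto
    have iN: "int (N - Suc 0) = int N - 1" using N by simp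
    have Yo: "Yo_num N ?L' = Y_num N ?L" using False sf(1) by (simp add: Yo_num_def)
    have Z: "Z_num N ?L = T_num N (Suc k)" "Z_num N ?L' = T_num N k"
      using False k rr lt by (auto simp: Z_num_def)
    show ?thesis using Y_rec[OF P' N r'] T_subtree[of N k]
      by (simp add: val1 val2 j iN Yo Z algebra_simps)
  qed
qed

section \<open>Packages and edges in the coordinates of \<open>mk\<close>\<close>

definition cyc :: "nat \<Rightarrow> nat list \<Rightarrow> nat list" where
  "cyc n \<pi> = tl (dropWhile (\<lambda>y. y \<noteq> n) \<pi>) @ takeWhile (\<lambda>y. y \<noteq> n) \<pi>"

lemma cyc_split: "n \<notin> set A \<Longrightarrow> cyc n (A @ n # B) = B @ A"
proof -
  assume n: "n \<notin> set A"
  have "dropWhile (\<lambda>y. y \<noteq> n) (A @ n # B) = n # B" "takeWhile (\<lambda>y. y \<noteq> n) (A @ n # B) = A"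
    using n by (induction A) auto
  then show ?thesis by (simp add: cyc_def)
qed

lemma cyc_rotate1: "n \<in> set \<pi> \<Longrightarrow> distinct \<pi> \<Longrightarrow> cyc n (rotate1 \<pi>) = cyc n \<pi>"
proof -
  assume "n \<in> set \<pi>" "distinct \<pi>"
  then obtain A B where AB: "\<pi> = A @ n # B" "n \<notin> set A" "n \<notin> set B" by (auto dest!: split_list)
  show ?thesis
  proof (cases A)
    case Nil
    then show ?thesis using AB cyc_split[of n B "[]"] cyc_split[of n "[]" B] by simp
  next
    case (Cons a A')
    then show ?thesis using AB cyc_split[of n A' "B @ [a]"] cyc_split[of n A B] by simp
  qed
qed

lemma cyc_rotate: "n \<in> set \<pi> \<Longrightarrow> distinct \<pi> \<Longrightarrow> cyc n (rotate k \<pi>) = cyc n \<pi>"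
  by (induction k) (auto simp: cyc_rotate1)

lemma cyc_mk: "is_nperm N L \<Longrightarrow> cyc (Suc N) (mk L c) = L"
proof -
  assume P: "is_nperm N L"
  have "Suc N \<notin> set (drop c L)" using P by (auto simp: is_nperm_def dest: in_set_dropD)
  then show ?thesis using is_nperm_length[OF P] by (simp add: mk_def cyc_split)
qed

lemma mk_rotate: "c \<le> length L \<Longrightarrow> \<exists>k. mk L c = rotate k (Suc (length L) # L)"
proof (induction c)
  case 0
  have "mk L 0 = rotate 1 (Suc (length L) # L)" by (simp add: mk_def)
  then show ?case by blast
next
  case (Suc c)
  then obtain k where k: "mk L c = rotate k (Suc (length L) # L)" by auto
  have "mk L (Suc c) = rotate (Suc k) (Suc (length L) # L)"
    using sig_mk[of c L] Suc.prems k by (simp add: sig_def)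
  then show ?case by blast
qed

text \<open>A class lies in the package of its own seed, which misses the successor of the head,
  and, if its first two entries are consecutive, in that of a child seed, which misses the head
  itself. The predicate \<open>Q\<close> on the missing element serves tau-edges (second entry equal
  to it) and sigma-edges (different from it) alike.\<close>

lemma seed_packages:
  assumes P: "is_nperm N L" and N: "3 \<le> N" and c: "c \<le> N"
  shows "(\<exists>\<psi>. is_seed (Suc N) \<psi> \<and> mk L c \<in> perms (Suc N) \<psi> \<and> Q (mis (Suc N) \<psi>))
    \<longleftrightarrow> Q (nx N (hd L)) \<or> (L ! 0 = nx N (L ! 1) \<and> Q (L ! 0))" (is "?lhs \<longleftrightarrow> ?rhs")
proof
  assume ?lhs
  then obtain \<psi> where s: "is_seed (Suc N) \<psi>" "mk L c \<in> perms (Suc N) \<psi>" "Q (mis (Suc N) \<psi>)" by blast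
  define x where "x = mis (Suc N) \<psi>"
  obtain i k where ik: "mk L c = rotate k (take i \<psi> @ x # drop i \<psi>)" "i \<le> length \<psi>"
    using s(2) unfolding perms_def x_def by blast
  have l: "length \<psi> = N" "distinct \<psi>" "\<psi> ! 0 = Suc N" "x \<notin> set \<psi>" and xx: "x = nx N (\<psi> ! 1)"
    using s(1) by (auto simp: is_seed_def x_def mis_def nx_def)
  obtain \<phi> where \<phi>: "\<psi> = Suc N # \<phi>" using l N by (cases \<psi>) auto
  have \<phi>1: "\<phi> \<noteq> []" "\<psi> ! 1 = hd \<phi>" using l \<phi> N by (cases \<phi>; simp)+
  have xN: "x \<noteq> Suc N" using l \<phi> by auto
  have d: "distinct (take i \<psi> @ x # drop i \<psi>)" "Suc N \<in> set (take i \<psi> @ x # drop i \<psi>)"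
  proof -
    have "distinct (take i \<psi> @ drop i \<psi>)" using l by simp
    then show "distinct (take i \<psi> @ x # drop i \<psi>)" using l(4) unfolding distinct_append
      by (auto dest: in_set_takeD in_set_dropD)
    have "Suc N \<in> set (take i \<psi> @ drop i \<psi>)" using \<phi> by simp
    then show "Suc N \<in> set (take i \<psi> @ x # drop i \<psi>)" unfolding set_append by auto
  qed
  have "L = cyc (Suc N) (take i \<psi> @ x # drop i \<psi>)"
    using cyc_mk[OF P, of c] cyc_rotate[OF d(2,1), of k] ik by simp
  also have "\<dots> = (if i = 0 then \<phi> @ [x] else take (i - 1) \<phi> @ x # drop (i - 1) \<phi>)"
    using cyc_split[of "Suc N" "[x]" \<phi>] cyc_split[of "Suc N" "[]"] xN by (cases i) (auto simp: \<phi>)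
  finally have L: "L = (if i = 0 then \<phi> @ [x] else take (i - 1) \<phi> @ x # drop (i - 1) \<phi>)" .
  \<comment> \<open>Insertion at position 1 puts \<open>x\<close> directly after the largest entry,
    so \<open>x\<close> becomes the head of \<open>L\<close> and \<open>\<psi>\<close> is the child
    seed; every other position keeps the head of \<open>\<phi>\<close>, and \<open>\<psi>\<close> is
    the own seed.\<close>
  show ?rhs
  proof (cases "i = 1")
    case True
    then have "L = x # \<phi>" using L by simp
    then have "L ! 0 = x \<and> L ! 1 = hd \<phi>" using \<phi>1 by (simp add: hd_conv_nth)
    then show ?thesis using s(3) xx \<phi>1 x_def by simp
  next
    case False
    then have "hd L = hd \<phi>" using L \<phi>1 by (cases \<phi>; cases i; cases "i - 1") auto
    then show ?thesis using s(3) xx \<phi>1 x_def by simp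
  qed
next
  assume ?rhs
  have len: "length L = N" using is_nperm_length[OF P] .
  obtain A x B where AB: "L = A @ x # B" "A @ B \<noteq> []" "x = nx N (hd (A @ B))" "Q x"
  proof (cases "Q (nx N (hd L))")
    case True
    obtain A B where AB: "L = A @ nx N (hd A) # B" "A \<noteq> []" "hd A = hd L" using nperm_split[OF P N] .
    have "Q (nx N (hd A))" unfolding AB(3) by (rule True)
    moreover have "A @ B \<noteq> []" "nx N (hd A) = nx N (hd (A @ B))" using AB(2) by simp_all
    ultimately show thesis using that[OF AB(1)] by blast
  next
    case False
    then have f: "L ! 0 = nx N (L ! 1)" "Q (L ! 0)" using \<open>?rhs\<close> by auto
    obtain b C where bC: "L = b # C" "C \<noteq> []" using len N by (cases L; cases "tl L") auto
    then have "L ! 1 = hd C" by (simp add: hd_conv_nth)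
    with f bC that[of "[]" b C] show thesis by simp
  qed
  define \<psi> where "\<psi> = Suc N # A @ B"
  have p1: "\<psi> ! 1 = hd (A @ B)" using AB(2) by (simp add: \<psi>_def hd_conv_nth)
  have m: "mis (Suc N) \<psi> = x" using p1 AB(3) by (simp add: mis_def nx_def)
  have sL: "distinct (A @ x # B)" "set (A @ x # B) = {1..N}" using P AB(1) by (auto simp: is_nperm_def)
  have nN: "Suc N \<notin> set (A @ x # B)" unfolding sL by simp
  have "is_seed (Suc N) \<psi>"
    unfolding is_seed_def
  proof (intro conjI)
    show "length \<psi> = Suc N - 1" using len AB(1) by (simp add: \<psi>_def)
    show "distinct \<psi>" using sL nN by (auto simp: \<psi>_def)
    have "set (A @ B) \<subseteq> {1..N}" using sL(2) by auto
    then show "set \<psi> \<subseteq> {1..Suc N}" by (auto simp: \<psi>_def)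
    show "\<psi> ! 0 = Suc N" by (simp add: \<psi>_def)
    have "oplus1 (Suc N) (\<psi> ! 1) = x" using m by (simp add: mis_def)
    moreover have "x \<notin> set \<psi>" using sL(1) nN by (auto simp: \<psi>_def)
    ultimately show "oplus1 (Suc N) (\<psi> ! 1) \<notin> set \<psi>" by simp
  qed
  moreover have "mk L c \<in> perms (Suc N) \<psi>"
  proof -
    obtain k where "mk L c = rotate k (Suc N # L)" using mk_rotate[of c L] len c by auto
    moreover have "take (Suc (length A)) \<psi> @ x # drop (Suc (length A)) \<psi> = Suc N # L"
      by (simp add: \<psi>_def AB(1))
    moreover have "Suc (length A) \<le> length \<psi>" by (simp add: \<psi>_def)
    ultimately show ?thesis unfolding perms_def m by (metis (mono_tags, lifting) mem_Collect_eq)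
  qed
  ultimately show ?lhs using m AB(4) by auto
qed

definition tau_at :: "nat \<Rightarrow> nat list \<Rightarrow> nat \<Rightarrow> bool" where
  "tau_at N L c \<longleftrightarrow> jpos N L = Suc c \<or> (c = N \<and> L ! 0 = nx N (L ! 1))"

lemma mk_nth1: "is_nperm N L \<Longrightarrow> 3 \<le> N \<Longrightarrow> c \<le> N \<Longrightarrow>
    mk L c ! 1 = (if Suc c < N then L ! Suc c else if Suc c = N then Suc N else L ! 0)"
  using is_nperm_length[of N L] by (auto simp: mk_def nth_append nth_Cons' min_def)

lemma nth_eq_nx_hd:
  assumes P: "is_nperm N L" and N: "3 \<le> N" and i: "i < N"
  shows "L ! i = nx N (hd L) \<longleftrightarrow> jpos N L = i"
proof -
  obtain A B where AB: "L = A @ nx N (hd A) # B" "A \<noteq> []" "hd A = hd L" using nperm_split[OF P N] .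
  have j: "jpos N L = length A" "length A < N"
    using split_facts(2,4)[OF P[unfolded AB(1)] AB(2) refl] AB(1) by auto
  have "L ! jpos N L = nx N (hd L)" unfolding j using AB by (metis nth_append_length)
  then show ?thesis using P i j is_nperm_length[OF P] by (metis is_nperm_def nth_eq_iff_index_eq)
qed

lemma second_is_x:
  assumes P: "is_nperm N L" and N: "3 \<le> N" and c: "c \<le> N"
  shows "mk L c ! 1 = nx N (hd L) \<longleftrightarrow> jpos N L = Suc c"
proof -
  have "Suc N \<noteq> nx N (hd L)" using nx_range[of N "hd L"] N by auto
  moreover have "L ! 0 \<noteq> nx N (hd L)" using nth_eq_nx_hd[OF P N, of 0] jpos_bounds[OF P N] N by simp
  ultimately show ?thesis
    using mk_nth1[OF P N c] nth_eq_nx_hd[OF P N, of "Suc c"] jpos_bounds[OF P N] N by auto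
qed

lemma second_is_hd:
  assumes P: "is_nperm N L" and N: "3 \<le> N" and c: "c \<le> N"
  shows "mk L c ! 1 = L ! 0 \<longleftrightarrow> c = N"
proof -
  have len: "length L = N" using is_nperm_length[OF P] .
  then have "L ! 0 \<in> set L" using N by auto
  then have "L ! 0 \<noteq> Suc N" using P by (auto simp: is_nperm_def)
  moreover have "Suc c < N \<Longrightarrow> L ! Suc c \<noteq> L ! 0" using P len by (auto simp: is_nperm_def nth_eq_iff_index_eq)
  ultimately show ?thesis using mk_nth1[OF P N c] c by auto
qed

lemma tau_edges_mk:
  assumes P: "is_nperm N L" and N: "3 \<le> N" and c: "c \<le> N"
  shows "(mk L c, \<rho>) \<in> tau_edges (Suc N) \<longleftrightarrow> \<rho> = tau (mk L c) \<and> tau_at N L c"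
proof -
  have "(mk L c, \<rho>) \<in> tau_edges (Suc N) \<longleftrightarrow> \<rho> = tau (mk L c) \<and>
     (\<exists>\<psi>. is_seed (Suc N) \<psi> \<and> mk L c \<in> perms (Suc N) \<psi> \<and> mk L c ! 1 = mis (Suc N) \<psi>)"
    unfolding tau_edges_def by blast
  then show ?thesis
    unfolding seed_packages[OF P N c, where Q = "\<lambda>x. mk L c ! 1 = x"] second_is_x[OF P N c]
      second_is_hd[OF P N c] tau_at_def by blast
qed

lemma sigma_edges_mk:
  assumes P: "is_nperm N L" and N: "3 \<le> N" and c: "c \<le> N" and nt: "\<not> tau_at N L c"
  shows "(mk L c, sig (mk L c)) \<in> sigma_edges (Suc N)"
proof -
  have "mk L c ! 1 \<noteq> nx N (hd L)" using nt second_is_x[OF P N c] by (simp add: tau_at_def)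
  then have "\<exists>\<psi>. is_seed (Suc N) \<psi> \<and> mk L c \<in> perms (Suc N) \<psi> \<and> mk L c ! 1 \<noteq> mis (Suc N) \<psi>"
    using seed_packages[OF P N c, where Q = "\<lambda>x. mk L c ! 1 \<noteq> x"] by blast
  then show ?thesis unfolding sigma_edges_def by blast
qed

lemma tau_at_own:
  assumes P: "is_nperm N L" and N: "3 \<le> N" and j: "jpos N L = Suc c"
  obtains A y B where "L = A @ y # nx N (hd (A @ [y])) # B" "c = length A"
proof -
  obtain A B where AB: "L = A @ nx N (hd A) # B" "A \<noteq> []" "hd A = hd L" using nperm_split[OF P N] .
  have "length A = Suc c" using split_facts(2)[OF P[unfolded AB(1)] AB(2) refl] AB(1) j by simp
  then obtain A' y where "A = A' @ [y]" by (metis length_Suc_conv_rev)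
  with AB \<open>length A = Suc c\<close> that[of A' y B] show thesis by simp
qed

text \<open>The exchange at \<open>pi0\<close> matches the special cases of the three value lemmas:
  the added sigma-edge is the case \<open>desc N\<close> of \<open>val_wrap\<close>, the two deleted
  tau-edges are the exclusions in \<open>val_tau_own\<close> and
  \<open>val_tau_child\<close>.\<close>

lemma edge_step:
  assumes P: "is_nperm N L" and N: "3 \<le> N" and c: "c \<le> N" and e: "(mk L c, \<rho>) \<in> path_edges (Suc N)"
  shows "\<exists>L' c'. \<rho> = mk L' c' \<and> is_nperm N L' \<and> c' \<le> N \<and> val N L' c' = val N L c + 1"
proof -
  have len: "length L = N" using is_nperm_length[OF P] .
  have sg: ?thesis if "\<rho> = sig (mk L c)" "\<not> tau_at N L c \<or> mk L c = pi0 (Suc N)"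
  proof -
    have nt: "\<not> tau_at N L c \<or> (L = desc N \<and> c = N)"
    proof (cases "mk L c = pi0 (Suc N)")
      case True
      then have "L = desc N" using cyc_mk[OF P, of c] cyc_mk[OF desc_nperm, of N N] by (simp add: pi0_mk)
      moreover have "mk L c ! 1 = mk L N ! 1" using True \<open>L = desc N\<close> by (simp add: pi0_mk)
      then have "c = N" using second_is_hd[OF P N c] second_is_hd[OF P N order_refl] by simp
      ultimately show ?thesis by simp
    qed (use that in auto)
    show ?thesis
    proof (cases "c < N")
      case True
      then have "\<rho> = mk L (Suc c)" using that(1) sig_mk[of c L] len by simp
      moreover have "val N L (Suc c) = val N L c + 1"
        using nt True by (intro val_sigma) (auto simp: tau_at_def)
      ultimately show ?thesis using P True by (metis Suc_leI)
    next
      case False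
      then have cN: "c = N" using c by simp
      then have "\<rho> = mk L 0" using that(1) sig_mk_last[of L] len by simp
      moreover have "val N L 0 = val N L N + 1"
        using nt cN by (intro val_wrap[OF P N]) (auto simp: tau_at_def)
      ultimately show ?thesis using P cN by (metis le0)
    qed
  qed
  have ta: ?thesis if "\<rho> = tau (mk L c)" "tau_at N L c" "mk L c \<noteq> pi0 (Suc N)"
    "\<not> (mk L c = tau (sig (pi0 (Suc N))) \<and> \<rho> = sig (pi0 (Suc N)))"
  proof (cases "jpos N L = Suc c")
    case True
    obtain A y B where AB: "L = A @ y # nx N (hd (A @ [y])) # B" "c = length A"
      using tau_at_own[OF P N True] .
    define x where "x = nx N (hd (A @ [y]))"
    have \<rho>: "\<rho> = mk (A @ x # y # B) c" using that(1) AB tau_mk_swap[of A y x B] by (simp add: x_def)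
    have P': "is_nperm N (A @ x # y # B)" using P unfolding AB(1) x_def[symmetric] by (auto simp: is_nperm_def)
    have "\<not> (A = [] \<and> A @ x # y # B = desc N)"
    proof
      assume "A = [] \<and> A @ x # y # B = desc N"
      then have "\<rho> = mk (desc N) 0" using \<rho> AB(2) by auto
      then have "\<rho> = sig (pi0 (Suc N))"
        using sig_mk_last[of "desc N"] is_nperm_length[OF desc_nperm, of N] by (simp add: pi0_mk)
      then show False using that(1,4) tau_tau by metis
    qed
    then have "val N (A @ x # y # B) c = val N L c + 1"
      using val_tau_own[of N A y x B] P N AB x_def by simp
    then show ?thesis using \<rho> P' c by blast
  next
    case False
    then have cN: "c = N" "L ! 0 = nx N (L ! 1)" using that(2) by (auto simp: tau_at_def)
    obtain b C where bC: "L = b # C" "C \<noteq> []" using len N by (cases L; cases "tl L") auto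
    have b: "b = nx N (hd C)" using cN bC by (simp add: hd_conv_nth)
    have "L \<noteq> desc N" using that(3) cN by (auto simp: pi0_mk)
    then have v: "val N (C @ [b]) (length C) = val N L c + 1" using val_tau_child[of N b C] P N b bC cN by simp
    have "\<rho> = mk (C @ [b]) (length C)" using that(1) tau_mk_front[of b C] bC len cN by simp
    moreover have "is_nperm N (C @ [b])" using P bC by (auto simp: is_nperm_def)
    moreover have "length C \<le> N" using bC len by simp
    ultimately show ?thesis using v by blast
  qed
  have sgf: "\<rho> = sig (mk L c)" if "(mk L c, \<rho>) \<in> sigma_edges (Suc N)"
    using that unfolding sigma_edges_def by blast
  from e consider "(mk L c, \<rho>) \<in> sigma_edges (Suc N)" "\<nexists>\<rho>'. (mk L c, \<rho>') \<in> tau_edges (Suc N)"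
    | "mk L c = pi0 (Suc N)" "\<rho> = sig (mk L c)"
    | "(mk L c, \<rho>) \<in> tau_edges (Suc N)" "mk L c \<noteq> pi0 (Suc N) \<or> \<rho> \<noteq> tau (mk L c)"
      "\<not> (mk L c = tau (sig (pi0 (Suc N))) \<and> \<rho> = sig (pi0 (Suc N)))"
    unfolding path_edges_def by (simp only: Un_iff mem_Collect_eq Diff_iff insert_iff empty_iff fst_conv prod.inject) metis
  then show ?thesis
  proof cases
    case 1
    then have "\<not> tau_at N L c" using tau_edges_mk[OF P N c] by blast
    then show ?thesis using sg sgf[OF 1(1)] by blast
  next
    case 2
    then show ?thesis using sg by blast
  next
    case 3
    then have "\<rho> = tau (mk L c)" "tau_at N L c" using tau_edges_mk[OF P N c] by blast+
    then show ?thesis using ta 3(2,3) by blast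
  qed
qed

text \<open>Sigma supplies the predecessor except at two places. At \<open>c = jpos N L\<close> the
  class is entered by tau, from the sibling with \<open>x\<close> one place further right or, if
  \<open>x\<close> is last, from the parent at \<open>c = N\<close>. At \<open>c = 0\<close>, if
  there is a subtree, the path returns by tau from the class with the first two entries
  interchanged.\<close>

lemma pred_exists:
  assumes P: "is_nperm N L" and N: "3 \<le> N" and c: "c \<le> N" and s: "mk L c \<noteq> tau (pi0 (Suc N))"
  shows "\<exists>L' c'. is_nperm N L' \<and> c' \<le> N \<and> (mk L' c', mk L c) \<in> path_edges (Suc N)"
proof -
  have len: "length L = N" using is_nperm_length[OF P] .
  have sigI: "(mk L c', sig (mk L c')) \<in> path_edges (Suc N)" if "c' \<le> N" "\<not> tau_at N L c'" for c'
    using sigma_edges_mk[OF P N that] tau_edges_mk[OF P N that(1)] that(2) unfolding path_edges_def by auto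
  have tauI: "(mk L' c', mk L c) \<in> path_edges (Suc N)"
    if "is_nperm N L'" "c' \<le> N" "mk L c = tau (mk L' c')" "tau_at N L' c'" "mk L c \<noteq> sig (pi0 (Suc N))" for L' c'
  proof -
    have "mk L' c' \<noteq> pi0 (Suc N)" using that(3) s by auto
    then show ?thesis using tau_edges_mk[OF that(1) N that(2)] that unfolding path_edges_def by auto
  qed
  have sp: "sig (pi0 (Suc N)) = mk (desc N) 0"
    using sig_mk_last[of "desc N"] is_nperm_length[OF desc_nperm, of N] by (simp add: pi0_mk)
  show ?thesis
  proof (cases c)
    case (Suc c')
    show ?thesis
    proof (cases "jpos N L = c")
      case False
      then have "\<not> tau_at N L c'" using Suc c by (auto simp: tau_at_def)
      moreover have "sig (mk L c') = mk L c" using sig_mk[of c' L] Suc c len by simp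
      ultimately show ?thesis using sigI[of c'] P Suc c by (metis Suc_leD)
    next
      case True
      obtain A B where AB: "L = A @ nx N (hd A) # B" "A \<noteq> []" "hd A = hd L" using nperm_split[OF P N] .
      define x where "x = nx N (hd A)"
      have lA: "length A = c" using split_facts(2)[OF P[unfolded AB(1)] AB(2) refl] AB(1) True by simp
      have AB': "L = A @ x # B" using AB(1) x_def by simp
      show ?thesis
      proof (cases B)
        case Nil
        have P': "is_nperm N (x # A)" using P AB' Nil by (auto simp: is_nperm_def)
        have lN: "Suc (length A) = N" using len AB' Nil by simp
        have "tau (mk (x # A) N) = mk L c" using tau_mk_front[of x A] AB' Nil lN lA by simp
        moreover have "tau_at N (x # A) N" using x_def AB(2) by (simp add: tau_at_def hd_conv_nth)
        moreover have "mk L c \<noteq> sig (pi0 (Suc N))"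
        proof
          assume a: "mk L c = sig (pi0 (Suc N))"
          then have "L = desc N" using sp cyc_mk[OF P, of c] cyc_mk[OF desc_nperm, of N 0] by simp
          then have "mk L c ! 1 = mk L 0 ! 1" using a sp by simp
          then have "Suc N = L ! 1" using lA lN N mk_nth1[OF P N c] mk_nth1[OF P N, of 0] by simp
          moreover have "L ! 1 \<in> {1..N}" using P len N nth_mem[of 1 L] by (auto simp: is_nperm_def)
          ultimately show False by simp
        qed
        ultimately show ?thesis using tauI[OF P', of N] P' by auto
      next
        case (Cons y B')
        have P': "is_nperm N (A @ y # x # B')" using P AB' Cons by (auto simp: is_nperm_def)
        have "tau (mk (A @ y # x # B') c) = mk L c" using tau_mk_swap[of A y x B'] AB' Cons lA by simp
        moreover have "tau_at N (A @ y # x # B') c"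
          using split_facts(2)[of N "A @ [y]" x B'] P' x_def AB(2) lA by (simp add: tau_at_def)
        moreover have "mk L c \<noteq> sig (pi0 (Suc N))"
        proof
          assume a: "mk L c = sig (pi0 (Suc N))"
          then have L: "L = desc N" using sp cyc_mk[OF P, of c] cyc_mk[OF desc_nperm, of N 0] by simp
          then have "hd (mk L c) = hd (mk L 0)" using a sp by simp
          then have "x = hd A" using AB' lA AB(2) by (simp add: mk_def)
          then show False using P AB' AB(2) by (auto simp: is_nperm_def)
        qed
        ultimately show ?thesis using tauI[OF P', of c] P' c by auto
      qed
    qed
  next
    case 0
    have w: "sig (mk L N) = mk L 0" using sig_mk_last[of L] len by simp
    show ?thesis
    proof (cases "tau_at N L N \<and> L \<noteq> desc N")
      case False
      have "(mk L N, mk L 0) \<in> path_edges (Suc N)"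
      proof (cases "L = desc N")
        case True
        then show ?thesis using w by (simp add: path_edges_def pi0_mk)
      qed (use False sigI[of N] w in simp)
      then show ?thesis using P 0 by blast
    next
      case True
      then have h: "L ! 0 = nx N (L ! 1)" using jpos_bounds[OF P N] by (auto simp: tau_at_def)
      obtain b a C where bC: "L = b # a # C" using len N by (cases L; cases "tl L") auto
      have P': "is_nperm N (a # b # C)" using P bC by (auto simp: is_nperm_def)
      have "mk L c = tau (mk (a # b # C) 0)" using tau_mk_swap[of "[]" a b C] bC 0 by simp
      moreover have "tau_at N (a # b # C) 0"
        using split_facts(2)[of N "[a]" b C] P' h bC by (simp add: tau_at_def)
      moreover have "mk L c \<noteq> sig (pi0 (Suc N))"
        using sp cyc_mk[OF P, of c] cyc_mk[OF desc_nperm, of N 0] True by auto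
      ultimately show ?thesis using tauI[OF P', of 0] P' by auto
    qed
  qed
qed

lemma val_start:
  assumes N: "3 \<le> N"
  obtains L c where "is_nperm N L" "c \<le> N" "tau (pi0 (Suc N)) = mk L c" "val N L c = 0"
proof -
  obtain k where k: "N = Suc k" using N by (cases N) auto
  define C where "C = desc k"
  have D: "desc N = N # C" by (simp add: desc_def C_def k)
  have lC: "Suc (length C) = N" using is_nperm_length[OF desc_nperm, of N] D by simp
  have hC: "hd C = k" using N by (simp add: C_def desc_def k)
  have "C \<noteq> []" using lC N by auto
  have P: "is_nperm N (C @ [N])" using desc_nperm[of N] unfolding D by (auto simp: is_nperm_def)
  have N': "N = nx N (hd C)" using hC by (simp add: nx_def oplus1_def k)
  note sf = split_facts[OF P \<open>C \<noteq> []\<close> N']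
  have "run N (up N (C @ [N])) = N" using sf(1) D run_desc[of N] N by simp
  then have r: "run N (C @ [N]) = N" using run_rec[OF P N] sf(2) lC by auto
  have h: "hd (C @ [N]) mod N = k" using k hC \<open>C \<noteq> []\<close> by auto
  have "int (length C) = int N - 1" "int k = int N - 1" using lC k by auto
  then have "val N (C @ [N]) (length C) = 0"
    unfolding val_def Y_full[OF r] Z_num_def if_P[OF r] sf(2) h by (simp add: algebra_simps)
  moreover have "tau (pi0 (Suc N)) = mk (C @ [N]) (length C)"
    using tau_mk_front[of N C] lC by (simp add: pi0_mk D)
  moreover have "length C \<le> N" using lC by simp
  ultimately show thesis using that P by blast
qed

text \<open>Every walk of \<open>k\<close> edges from the start ends at value \<open>k\<close>, and
  following predecessors leads back to the start. Hence the length of a walk to the vertex is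
  determined by \<open>val\<close>, and the \<open>LEAST\<close> in \<open>rank\<close> is
  attained.\<close>

theorem rank_mk:
  assumes P: "is_nperm N L" and N: "3 \<le> N" and c: "c \<le> N"
  shows "int (rank (Suc N) (mk L c)) = val N L c"
proof -
  obtain L0 c0 where L0: "is_nperm N L0" "c0 \<le> N" "tau (pi0 (Suc N)) = mk L0 c0" "val N L0 c0 = 0"
    using val_start[OF N] .
  define R where "R = path_edges (Suc N)"
  have fwd: "\<exists>L' c'. \<rho> = mk L' c' \<and> is_nperm N L' \<and> c' \<le> N \<and> val N L' c' = int k"
    if "(mk L0 c0, \<rho>) \<in> R ^^ k" for k \<rho>
    using that
  proof (induction k arbitrary: \<rho>)
    case 0
    then show ?case using L0 by auto
  next
    case (Suc k)
    then obtain \<rho>' where 1: "(mk L0 c0, \<rho>') \<in> R ^^ k" "(\<rho>', \<rho>) \<in> R" by auto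
    then obtain L' c' where "\<rho>' = mk L' c'" "is_nperm N L'" "c' \<le> N" "val N L' c' = int k"
      using Suc.IH by blast
    then show ?case using edge_step[of N L' c' \<rho>] 1(2) N unfolding R_def by force
  qed
  \<comment> \<open>\<open>edge_step\<close> yields only some coordinates of its target; as
    \<open>mk\<close> is injective, the value is the same for any choice.\<close>
  have uniq: "val N L' c' = val N L'' c''" 
    if "mk L' c' = mk L'' c''" "is_nperm N L'" "c' \<le> N" "is_nperm N L''" "c'' \<le> N" for L' c' L'' c''
  proof -
    have l: "L' = L''" using cyc_mk[OF that(2), of c'] cyc_mk[OF that(4), of c''] that(1) by simp
    have "length (takeWhile (\<lambda>y. y \<noteq> Suc N) (mk M a)) = N - a" if "is_nperm N M" for M a
    proof -
      have "Suc N \<notin> set (drop a M)" using that by (auto simp: is_nperm_def dest: in_set_dropD)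
      then have "length (takeWhile (\<lambda>y. y \<noteq> Suc N) (mk M a)) = length (drop a M)"
        using is_nperm_length[OF that] by (simp add: mk_def takeWhile_append2 flip: ipos_def) (metis ipos_append ipos_def length_drop)
      then show ?thesis using is_nperm_length[OF that] by simp
    qed
    then have "N - c' = N - c''" using that by metis
    then have "c' = c''" using that by simp
    then show ?thesis using l by simp
  qed
  define V where "V = (\<lambda>(L, c). val N L c) ` ({L. is_nperm N L} \<times> {..N})"
  have "{L. is_nperm N L} \<subseteq> {L. set L \<subseteq> {1..N} \<and> length L = N}"
    using is_nperm_length by (auto simp: is_nperm_def)
  then have "finite {L. is_nperm N L}" using finite_lists_length_eq[of "{1..N}" N] finite_subset by blast
  then have finV: "finite V" unfolding V_def by simp
  have minV: "Min V \<le> val N L' c'" if "is_nperm N L'" "c' \<le> N" for L' c'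
    using finV that by (intro Min_le) (auto simp: V_def)
  text \<open>Going backwards decreases the value, and there are only finitely many values.\<close>
  have bwd: "\<exists>k. (mk L0 c0, mk L' c') \<in> R ^^ k" if "is_nperm N L'" "c' \<le> N" for L' c'
    using that
  proof (induction "nat (val N L' c' - Min V)" arbitrary: L' c' rule: less_induct)
    case less
    show ?case
    proof (cases "mk L' c' = tau (pi0 (Suc N))")
      case True
      then show ?thesis using L0(3) by (intro exI[of _ 0]) simp
    next
      case False
      obtain L1 c1 where 1: "is_nperm N L1" "c1 \<le> N" "(mk L1 c1, mk L' c') \<in> R"
        using pred_exists[OF less.prems(1) N less.prems(2) False] unfolding R_def by blast
      obtain L2 c2 where 2: "mk L' c' = mk L2 c2" "is_nperm N L2" "c2 \<le> N" "val N L2 c2 = val N L1 c1 + 1"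
        using edge_step[OF 1(1) N 1(2)] 1(3) unfolding R_def by blast
      have "val N L' c' = val N L1 c1 + 1" using uniq[OF 2(1) less.prems 2(2,3)] 2(4) by simp
      then have "nat (val N L1 c1 - Min V) < nat (val N L' c' - Min V)" using minV[OF 1(1,2)] by simp
      then obtain k where "(mk L0 c0, mk L1 c1) \<in> R ^^ k" using less.hyps 1(1,2) by blast
      then have "(mk L0 c0, mk L' c') \<in> R ^^ Suc k" using 1(3) by auto
      then show ?thesis by blast
    qed
  qed
  obtain k where k: "(mk L0 c0, mk L c) \<in> R ^^ k" using bwd[OF P c] by blast
  have all: "int k' = val N L c" if "(mk L0 c0, mk L c) \<in> R ^^ k'" for k'
    using fwd[OF that] uniq P c by metis
  have "(mk L0 c0, mk L c) \<in> R ^^ (LEAST k. (mk L0 c0, mk L c) \<in> R ^^ k)" using k by (rule LeastI)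
  then show ?thesis using all unfolding rank_def L0(3) R_def by blast
qed

section \<open>Iterated move-to-front and size estimates\<close>

lemma nth_ipos:
  assumes "v \<in> set L"
  shows "ipos v L < length L" "L ! ipos v L = v"
proof -
  obtain A B where "L = A @ v # B" "v \<notin> set A" using assms by (meson split_list_first)
  then show "ipos v L < length L" "L ! ipos v L = v" using ipos_append[of v A B] by auto
qed

lemma ipos_move_to_front:
  assumes "distinct L" "x \<in> set L" "y \<in> set L" "y \<noteq> x"
  shows "ipos y (x # remove1 x L) = ipos y L + (if ipos y L < ipos x L then 1 else 0)"
proof -
  obtain A B where L: "L = A @ x # B" "x \<notin> set A" using assms(2) by (meson split_list_first)
  have x: "ipos x L = length A" using ipos_append[OF L(2)] L(1) by simp
  have r: "remove1 x L = A @ B" using L by (simp add: remove1_append)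
  consider A1 A2 where "A = A1 @ y # A2" "y \<notin> set A1" 
    | B1 B2 where "B = B1 @ y # B2" "y \<notin> set B1" "y \<notin> set A"
    using assms L split_list_first[of y A] split_list_first[of y B] by auto
  then show ?thesis
  proof cases
    case 1
    then show ?thesis
      using x r L(1) assms(4) ipos_append[of y A1 "A2 @ x # B"] ipos_append[of y "x # A1" "A2 @ B"] by simp
  next
    case 2
    then show ?thesis
      using x r L(1) assms(4) ipos_append[of y "A @ x # B1" B2] ipos_append[of y "x # A @ B1" B2] by simp
  qed
qed

text \<open>The entry moved in step \<open>i\<close> if \<open>d\<close> is the original head: every
  move raises the head by one modulo \<open>N\<close>, so the sequence of moved entries is known
  beforehand and only their positions must be found.\<close>

definition front :: "nat \<Rightarrow> nat \<Rightarrow> nat \<Rightarrow> nat" where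
  "front N d i = Suc ((d + i) mod N)"

lemma front_range: "1 \<le> N \<Longrightarrow> front N d i \<in> {1..N}"
  using mod_less_divisor[of N "d + i"] by (simp add: front_def Suc_le_eq)

lemma front_eq_iff: "i < N \<Longrightarrow> j < N \<Longrightarrow> front N d i = front N d j \<longleftrightarrow> i = j"
proof
  assume a: "i < N" "j < N" "front N d i = front N d j"
  then have "(d + i) mod N = (d + j) mod N" by (simp add: front_def)
  have "k = l" if "k \<le> l" "l < N" "(d + k) mod N = (d + l) mod N" for k l
  proof -
    have "N dvd d + l - (d + k)" using that by (intro iffD1[OF mod_eq_dvd_iff_nat]) auto
    then show ?thesis using that by (auto dest: dvd_imp_le)
  qed
  from this[of i j] this[of j i] show "i = j" using a \<open>(d + i) mod N = (d + j) mod N\<close>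
    by (metis nat_le_linear)
qed auto

lemma ups_nperm: "is_nperm N L \<Longrightarrow> 3 \<le> N \<Longrightarrow> is_nperm N ((up N ^^ s) L)"
  by (induction s) (auto simp: up_nperm)

lemma hd_ups: 
  assumes P: "is_nperm N L" and N: "3 \<le> N"
  shows "hd ((up N ^^ s) L) mod N = (hd L + s) mod N"
    and "nx N (hd ((up N ^^ s) L)) = front N (hd L) s"
proof -
  have h: "hd M \<in> {1..N}" if "is_nperm N M" for M
  proof -
    have "M \<noteq> []" using is_nperm_length[OF that] N by auto
    then show ?thesis using that hd_in_set[of M] by (auto simp: is_nperm_def)
  qed
  show *: "hd ((up N ^^ s) L) mod N = (hd L + s) mod N"
  proof (induction s)
    case (Suc s)
    have "hd ((up N ^^ Suc s) L) = hd ((up N ^^ s) L) mod N + 1"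
      using h[OF ups_nperm[OF P N, of s]] nx_mod by (simp add: hd_up)
    also have "\<dots> mod N = (hd ((up N ^^ s) L) + 1) mod N" by (simp add: mod_Suc_eq)
    also have "\<dots> = ((hd L + s) mod N + 1) mod N" by (metis Suc mod_add_left_eq)
    finally show ?case by (simp add: mod_Suc_eq)
  qed simp
  show "nx N (hd ((up N ^^ s) L)) = front N (hd L) s"
    using h[OF ups_nperm[OF P N, of s]] nx_mod * by (simp add: front_def)
qed

definition moved :: "nat \<Rightarrow> nat list \<Rightarrow> nat \<Rightarrow> nat set" where
  "moved N L s = (\<lambda>i. ipos (front N (hd L) i) L) ` {..<s}"

lemma front_moved:
  assumes P: "is_nperm N L" and N: "3 \<le> N" and s: "s \<le> t" "t < N"
  shows "ipos (front N (hd L) t) L \<notin> moved N L s"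
proof
  assume "ipos (front N (hd L) t) L \<in> moved N L s"
  then obtain i where i: "i < s" "ipos (front N (hd L) t) L = ipos (front N (hd L) i) L" by (auto simp: moved_def)
  have "front N (hd L) t \<in> set L" "front N (hd L) i \<in> set L"
    using P front_range[of N] N by (auto simp: is_nperm_def)
  then have "front N (hd L) t = front N (hd L) i" using i(2) nth_ipos(2) by metis
  then show False using front_eq_iff[of t N i] i s by simp
qed

lemma moved_Suc: "moved N L (Suc s) = insert (ipos (front N (hd L) s) L) (moved N L s)"
  by (auto simp: moved_def less_Suc_eq)

text \<open>A move shifts an unmoved entry by one exactly if the moved entry stood behind it at that
  moment. Unmoved entries keep their relative order, so this can be read off the original list; the
  order claim is therefore carried through the same induction.\<close>

lemma ipos_ups:
  assumes P: "is_nperm N L" and N: "3 \<le> N" and s: "s \<le> N"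
    and y: "y \<in> set L" "\<And>i. i < s \<Longrightarrow> y \<noteq> front N (hd L) i"
  shows "ipos y ((up N ^^ s) L) = ipos y L + card {j \<in> moved N L s. ipos y L < j}"
    and "\<And>z. z \<in> set L \<Longrightarrow> (\<And>i. i < s \<Longrightarrow> z \<noteq> front N (hd L) i) \<Longrightarrow>
      ipos y ((up N ^^ s) L) < ipos z ((up N ^^ s) L) \<longleftrightarrow> ipos y L < ipos z L"
proof -
  have "(\<forall>y. y \<in> set L \<and> (\<forall>i<s. y \<noteq> front N (hd L) i) \<longrightarrow>
      ipos y ((up N ^^ s) L) = ipos y L + card {j \<in> moved N L s. ipos y L < j})
    \<and> (\<forall>y z. y \<in> set L \<and> z \<in> set L \<and> (\<forall>i<s. y \<noteq> front N (hd L) i) \<and> (\<forall>i<s. z \<noteq> front N (hd L) i) \<longrightarrow>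
      (ipos y ((up N ^^ s) L) < ipos z ((up N ^^ s) L) \<longleftrightarrow> ipos y L < ipos z L))"
    using s
  proof (induction s)
    case (Suc s)
    define M where "M = (up N ^^ s) L"
    define x where "x = front N (hd L) s"
    have PM: "is_nperm N M" using ups_nperm[OF P N] by (simp add: M_def)
    have up: "(up N ^^ Suc s) L = x # remove1 x M" 
      using hd_ups(2)[OF P N, of s] by (simp add: up_def M_def x_def)
    have sets: "set M = set L" "distinct M" using PM P by (auto simp: is_nperm_def)
    have xL: "x \<in> set L" using P front_range[of N] N by (auto simp: is_nperm_def x_def)
    have xf: "\<forall>i<s. x \<noteq> front N (hd L) i" using front_eq_iff Suc.prems by (auto simp: x_def)
    note IH = Suc.IH[OF Suc_leD[OF Suc.prems], folded M_def]
    have IH1: "ipos y M = ipos y L + card {j \<in> moved N L s. ipos y L < j}"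
      if "y \<in> set L" "\<forall>i<s. y \<noteq> front N (hd L) i" for y using IH that by blast
    have IH2: "ipos y M < ipos z M \<longleftrightarrow> ipos y L < ipos z L"
      if "y \<in> set L" "\<forall>i<s. y \<noteq> front N (hd L) i" "z \<in> set L" "\<forall>i<s. z \<noteq> front N (hd L) i" for y z
      using IH that by blast
    have step: "ipos y ((up N ^^ Suc s) L) = ipos y M + (if ipos y L < ipos x L then 1 else 0)"
      if "y \<in> set L" "\<forall>i<Suc s. y \<noteq> front N (hd L) i" for y
    proof -
      have "y \<noteq> x" "\<forall>i<s. y \<noteq> front N (hd L) i" using that by (auto simp: x_def)
      then show ?thesis using ipos_move_to_front[of M x y] IH2[of y x] that xL xf sets up by simp
    qed
    have fin: "finite (moved N L s)" by (simp add: moved_def)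
    have xnm: "ipos x L \<notin> moved N L s" using front_moved[OF P N, of s s] Suc.prems by (simp add: x_def)
    show ?case
    proof (intro conjI allI impI)
      fix y assume y: "y \<in> set L \<and> (\<forall>i<Suc s. y \<noteq> front N (hd L) i)"
      have "{j \<in> moved N L (Suc s). ipos y L < j} = (if ipos y L < ipos x L then insert (ipos x L) else id)
          {j \<in> moved N L s. ipos y L < j}" unfolding moved_Suc x_def by auto
      then show "ipos y ((up N ^^ Suc s) L) = ipos y L + card {j \<in> moved N L (Suc s). ipos y L < j}"
        using step[of y] IH1[of y] y fin xnm by simp
    next
      fix y z assume yz: "y \<in> set L \<and> z \<in> set L \<and> (\<forall>i<Suc s. y \<noteq> front N (hd L) i) \<and> (\<forall>i<Suc s. z \<noteq> front N (hd L) i)"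
      have "ipos y M < ipos x M \<longleftrightarrow> ipos y L < ipos x L" "ipos z M < ipos x M \<longleftrightarrow> ipos z L < ipos x L"
        using IH2 yz xL xf by auto
      moreover have "ipos y M < ipos z M \<longleftrightarrow> ipos y L < ipos z L" using IH2 yz by auto
      moreover have "ipos y M \<noteq> ipos x M" "ipos z M \<noteq> ipos x M" 
        using yz xL nth_ipos(2)[of _ M] sets by (metis x_def lessI)+
      ultimately show "ipos y ((up N ^^ Suc s) L) < ipos z ((up N ^^ Suc s) L) \<longleftrightarrow> ipos y L < ipos z L"
        using step[of y] step[of z] yz by auto
    qed
  qed (simp add: moved_def)
  then show "ipos y ((up N ^^ s) L) = ipos y L + card {j \<in> moved N L s. ipos y L < j}"
    and "\<And>z. z \<in> set L \<Longrightarrow> (\<And>i. i < s \<Longrightarrow> z \<noteq> front N (hd L) i) \<Longrightarrow>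
      ipos y ((up N ^^ s) L) < ipos z ((up N ^^ s) L) \<longleftrightarrow> ipos y L < ipos z L"
    using y by auto
qed

lemma jpos_ups:
  assumes P: "is_nperm N L" and N: "3 \<le> N" and s: "s < N"
  shows "jpos N ((up N ^^ s) L) = ipos (front N (hd L) s) L
    + card {j \<in> moved N L s. ipos (front N (hd L) s) L < j}"
  unfolding jpos_def hd_ups(2)[OF P N]
  using s front_range[of N "hd L" s] N P front_eq_iff[of s N _ "hd L"]
  by (intro ipos_ups(1)[OF P N]) (auto simp: is_nperm_def)

lemma moved_bounds:
  assumes P: "is_nperm N L" and N: "3 \<le> N"
  shows "moved N L s \<subseteq> {..<N}" "card (moved N L s) \<le> s" "finite (moved N L s)"
proof -
  show "moved N L s \<subseteq> {..<N}"
  proof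
    fix j assume "j \<in> moved N L s"
    then obtain i where j: "j = ipos (front N (hd L) i) L" by (auto simp: moved_def)
    have "front N (hd L) i \<in> set L" using P front_range[of N] N by (auto simp: is_nperm_def)
    then show "j \<in> {..<N}" using nth_ipos(1)[of "front N (hd L) i" L] is_nperm_length[OF P] j by simp
  qed
  show "card (moved N L s) \<le> s" unfolding moved_def using card_image_le[of "{..<s}"] by force
  show "finite (moved N L s)" by (simp add: moved_def)
qed

text \<open>The run grows with each parent until it is complete, so \<open>N - 1\<close> moves
  always reach the spine. The program starts its evaluation there.\<close>

lemma run_ups:
  assumes P: "is_nperm N L" and N: "3 \<le> N"
  shows "min N (Suc s) \<le> run N ((up N ^^ s) L)"
proof (induction s)
  case 0
  have "1 \<le> run N L" using is_nperm_length[OF P] N by (intro run_pos) auto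
  then show ?case by simp
next
  case (Suc s)
  let ?M = "(up N ^^ s) L"
  have PM: "is_nperm N ?M" by (rule ups_nperm[OF P N])
  show ?case
  proof (cases "run N ?M = N")
    case True
    then have "run N (up N ?M) = N" using run_rec[OF PM N] jpos_bounds[OF PM N] N
      by (auto split: if_splits)
    then show ?thesis by simp
  next
    case False
    then have "run N ?M < N" using run_le_N[OF PM] by simp
    then have "run N ?M < run N (up N ?M)" by (rule run_up_less[OF PM N])
    then show ?thesis using Suc by simp
  qed
qed

section \<open>Size bounds for the tabulated and computed values\<close>

text \<open>The factor of the recursion is 0 at \<open>i = N - 1\<close>, so the product stays 0
  afterwards although later factors are negative.\<close>

lemma e_num_bounds: "1 \<le> N \<Longrightarrow> 0 \<le> e_num N i \<and> e_num N i \<le> int (Suc N) ^ (i + 1) \<and> (N \<le> i \<longrightarrow> e_num N i = 0)"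
proof (induction i)
  case (Suc i)
  then have IH: "0 \<le> e_num N i" "e_num N i \<le> int (Suc N) ^ (i + 1)" by auto
  show ?case
  proof (cases "Suc i < N")
    case True
    then have "(int N - 1 - int i) * e_num N i \<le> int (Suc N) * int (Suc N) ^ (i + 1)"
      using IH by (intro mult_mono) auto
    then show ?thesis using IH True by (simp add: e_num.simps(2))
  next
    case False
    then have "i = N - 1 \<or> e_num N i = 0" using Suc by auto
    then have "e_num N (Suc i) = 0" using Suc.prems by (auto simp: e_num.simps(2))
    then show ?thesis by simp
  qed
qed simp

lemma T_num_bounds: "1 \<le> N \<Longrightarrow> 0 \<le> T_num N i \<and> T_num N i \<le> int (Suc N) ^ (i + 2)"
proof (induction i)
  case (Suc i)
  have "T_num N (Suc i) \<le> int (Suc N) ^ (i + 2) + int (Suc N) ^ (i + 2)"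
    using Suc e_num_bounds[of N "Suc i"] by (simp add: T_num.simps(2))
  also have "\<dots> = 2 * int (Suc N) ^ (i + 2)" by simp
  also have "\<dots> \<le> int (Suc N) * int (Suc N) ^ (i + 2)" using Suc.prems by (intro mult_right_mono) auto
  finally show ?case using Suc e_num_bounds[of N "Suc i"] by (simp add: T_num.simps(2))
qed simp

lemma U_num_bounds: "1 \<le> N \<Longrightarrow> 0 \<le> U_num N i \<and> U_num N i \<le> int (Suc N) ^ (i + 3)"
proof (induction i)
  case (Suc i)
  have e: "Suc i + 2 = i + 3" by simp
  have "U_num N (Suc i) \<le> int (Suc N) ^ (i + 3) + int (Suc N) ^ (i + 3)"
    using Suc T_num_bounds[of N "Suc i", unfolded e] unfolding U_num.simps(2) by linarith
  also have "\<dots> = 2 * int (Suc N) ^ (i + 3)" by simp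
  also have "\<dots> \<le> int (Suc N) * int (Suc N) ^ (i + 3)" using Suc.prems by (intro mult_right_mono) auto
  also have "\<dots> = int (Suc N) ^ (Suc i + 3)" by (simp only: add_Suc power_Suc)
  finally show ?case using Suc T_num_bounds[of N "Suc i"] unfolding U_num.simps(2) by auto
qed simp

lemma M_num_bounds: 
  assumes "3 \<le> N"
  shows "2 \<le> M_num N" "M_num N \<le> int (Suc N) ^ N"
proof -
  have "2 * 2 \<le> (int N + 1) * (int N - 1)" using assms by (intro mult_mono) auto
  then show "2 \<le> M_num N" using M_num_U[OF assms] U_num_bounds[of N "N - 3"] assms by simp
  show "M_num N \<le> int (Suc N) ^ N" using e_num_bounds[of N "N - 1"] assms by (simp add: M_num_def)
qed

text \<open>The recursion subtracts, so it does not show the sign; but the value at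
  \<open>c = 0\<close> is a rank.\<close>

lemma Y_num_nonneg: "is_nperm N L \<Longrightarrow> 3 \<le> N \<Longrightarrow> 0 \<le> Y_num N L"
  using rank_mk[of N L 0] jpos_bounds[of N L] by (simp add: val_def)

text \<open>Coming down from the spine, only \<open>N + 1\<close> and, if \<open>jpos = r\<close>, a
  single \<open>T_num\<close> can raise the value. Each of at most \<open>N\<close> steps thus adds
  at most \<open>2 * K\<close>.\<close>

lemma Y_num_ups_le:
  assumes P: "is_nperm N L" and N: "3 \<le> N" and s: "s < N"
  shows "Y_num N ((up N ^^ s) L) \<le> int (Suc N) ^ (N + 4)"
proof -
  let ?n = "int (Suc N)"
  define K where "K = ?n ^ (N + 2)"
  have K: "?n \<le> K" "1 \<le> K" unfolding K_def using self_le_power[of ?n "N + 2"] one_le_power[of ?n "N + 2"] by auto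
  have gM: "2 * int N + g * (M_num N - 2) \<le> ?n * K" if "g \<le> int N" for g
  proof -
    have "g * (M_num N - 2) \<le> int N * (M_num N - 2)" using that M_num_bounds[OF N] by (intro mult_right_mono) auto
    then have "2 * int N + g * (M_num N - 2) \<le> int N * M_num N" by (simp add: algebra_simps)
    also have "\<dots> \<le> ?n * ?n ^ (N + 2)"
    proof (intro mult_mono)
      have "?n ^ N \<le> ?n ^ (N + 2)" by (intro power_increasing) auto
      then show "M_num N \<le> ?n ^ (N + 2)" using M_num_bounds(2)[OF N] by linarith
    qed (use M_num_bounds[OF N] in auto)
    finally show ?thesis by (simp add: K_def)
  qed
  have Tb: "T_num N i \<le> K" if "i \<le> N" for i
  proof -
    have "?n ^ (i + 2) \<le> K" unfolding K_def using that by (intro power_increasing) auto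
    then show ?thesis using T_num_bounds[of N i] N by linarith
  qed
  have main: "Y_num N ((up N ^^ (N - 1 - k)) L) \<le> ?n * K + int k * (2 * K)" if "k < N" for k
    using that
  proof (induction k)
    case 0
    have "run N ((up N ^^ (N - 1)) L) = N"
      using run_ups[OF P N, of "N - 1"] run_le_N[OF ups_nperm[OF P N]] N by (simp add: le_antisym)
    then have "Y_num N ((up N ^^ (N - 1)) L) = 2 * int N + int (hd ((up N ^^ (N - 1)) L) mod N) * (M_num N - 2)"
      by (rule Y_full)
    also have "\<dots> \<le> ?n * K"
    proof (rule gM)
      show "int (hd ((up N ^^ (N - 1)) L) mod N) \<le> int N" using mod_less_divisor[of N] N by (simp add: less_imp_le)
    qed
    finally show ?case by simp
  next
    case (Suc k)
    define s where "s = N - 1 - Suc k"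
    define M where "M = (up N ^^ s) L"
    have ss: "N - 1 - k = Suc s" using Suc.prems by (simp add: s_def)
    have PM: "is_nperm N M" using ups_nperm[OF P N] by (simp add: M_def)
    have IH: "Y_num N (up N M) \<le> ?n * K + int k * (2 * K)" using Suc ss by (simp add: M_def)
    define r where "r = min (jpos N M) (run N (up N M) - 1)"
    have r: "1 \<le> r" "r \<le> N" "r \<le> jpos N M" 
      using up_run_ge2[OF PM N] jpos_bounds[OF PM N] by (auto simp: r_def)
    have "Yo_num N M \<le> ?n * K + int k * (2 * K)"
    proof (cases "run N (up N M) = N")
      case True
      have "2 * int N + (int (hd M mod N) + 1) * (M_num N - 2) \<le> ?n * K"
      proof (rule gM)
        have "hd M mod N < N" using N by simp
        then show "int (hd M mod N) + 1 \<le> int N" by simp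
      qed
      moreover have "0 \<le> int k * (2 * K)" using K by simp
      ultimately have "2 * int N + (int (hd M mod N) + 1) * (M_num N - 2) \<le> ?n * K + int k * (2 * K)" by linarith
      then show ?thesis using True by (simp add: Yo_num_def)
    qed (use IH in \<open>simp add: Yo_num_def\<close>)
    moreover have "- ((int (jpos N M) - int r - 1) * T_num N (r - 1)) \<le> K"
    proof -
      have "(1 - (int (jpos N M) - int r)) * T_num N (r - 1) \<le> 1 * K"
        using r T_num_bounds[of N "r - 1"] Tb[of "r - 1"] N by (intro mult_mono) auto
      then show ?thesis by (simp add: algebra_simps)
    qed
    moreover have "0 \<le> (int N + 2) * int (jpos N M)" by simp
    moreover have "0 \<le> U_num N (r - 1)" "int N + 1 \<le> K" using U_num_bounds[of N "r - 1"] N K by simp_all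
    ultimately have "Y_num N M \<le> ?n * K + int k * (2 * K) + K + K"
      using Y_rec[OF PM N r_def] by linarith
    then show ?case by (simp add: M_def s_def algebra_simps)
  qed
  have "Y_num N ((up N ^^ s) L) \<le> ?n * K + int (N - 1 - s) * (2 * K)" using main[of "N - 1 - s"] s by simp
  also have "\<dots> \<le> ?n * K + int N * (2 * K)" using K by (intro add_left_mono mult_right_mono) auto
  also have "\<dots> \<le> ?n * (?n * K)"
  proof -
    have "(?n + 2 * int N) * K \<le> (?n * ?n) * K" using K N
      by (intro mult_right_mono) (auto simp: algebra_simps intro: mult_mono)
    then show ?thesis by (simp add: algebra_simps)
  qed
  also have "\<dots> = ?n ^ (N + 4)" by (simp add: K_def power_add power2_eq_square power4_eq_xxxx)
  finally show ?thesis .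
qed

section \<open>Counting positions by a digit sum\<close>

lemma sum_powers_less:
  assumes "finite Q" "Q \<subseteq> {..<q}" "2 \<le> n"
  shows "(\<Sum>j\<in>Q. n ^ j) < (n :: nat) ^ q"
proof -
  have "(\<Sum>j\<in>Q. n ^ j) \<le> (\<Sum>j<q. n ^ j)" using assms by (intro sum_mono2) auto
  also have "\<dots> < n ^ q"
  proof (induction q)
    case (Suc q)
    have "2 * n ^ q \<le> n * n ^ q" using assms(3) by (intro mult_right_mono) auto
    with Suc have "(\<Sum>j<q. n ^ j) + n ^ q < n ^ Suc q" unfolding power_Suc by linarith
    then show ?case by simp
  qed simp
  finally show ?thesis .
qed

text \<open>The powers below \<open>q\<close> sum to less than \<open>Suc N ^ q\<close> and vanish
  in the division; modulo \<open>N\<close> every remaining power is 1. Since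
  \<open>q \<notin> J\<close>, no digit at \<open>q\<close> itself is counted, and
  \<open>card J < N\<close> makes the residue the exact count.\<close>

lemma count_above:
  assumes J: "finite J" "q \<notin> J" "card J < N" and N: "1 \<le> N"
  shows "(\<Sum>j\<in>J. Suc N ^ j) div Suc N ^ q mod N = card {j \<in> J. q < j}"
proof -
  let ?n = "Suc N"
  have split: "(\<Sum>j\<in>J. ?n ^ j) = (\<Sum>j\<in>{j \<in> J. j < q}. ?n ^ j) + (\<Sum>j\<in>{j \<in> J. q < j}. ?n ^ j)"
  proof -
    have "j < q \<or> q < j" if "j \<in> J" for j using J(2) that by (cases j q rule: linorder_cases) auto
    then have "{j \<in> J. j < q} \<union> {j \<in> J. q < j} = J" by blast
    moreover have "(\<Sum>j\<in>{j \<in> J. j < q} \<union> {j \<in> J. q < j}. ?n ^ j)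
        = (\<Sum>j\<in>{j \<in> J. j < q}. ?n ^ j) + (\<Sum>j\<in>{j \<in> J. q < j}. ?n ^ j)"
      using J(1) by (intro sum.union_disjoint) auto
    ultimately show ?thesis by argo
  qed
  have "(\<Sum>j\<in>{j \<in> J. q < j}. ?n ^ j) = ?n ^ q * (\<Sum>j\<in>{j \<in> J. q < j}. ?n ^ (j - q))"
    unfolding sum_distrib_left by (rule sum.cong) (auto simp: power_add[symmetric])
  moreover have "(\<Sum>j\<in>{j \<in> J. j < q}. ?n ^ j) < ?n ^ q"
    using J N by (intro sum_powers_less) auto
  ultimately have d: "(\<Sum>j\<in>J. ?n ^ j) div ?n ^ q = (\<Sum>j\<in>{j \<in> J. q < j}. ?n ^ (j - q))"
    unfolding split by simp
  have one: "?n ^ k mod N = 1 mod N" for k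
    by (metis mod_add_self2 plus_1_eq_Suc power_mod power_one)
  have "(\<Sum>j\<in>{j \<in> J. q < j}. ?n ^ (j - q)) mod N = (\<Sum>j\<in>{j \<in> J. q < j}. ?n ^ (j - q) mod N) mod N"
    by (simp only: mod_sum_eq)
  also have "\<dots> = (\<Sum>j\<in>{j \<in> J. q < j}. 1) mod N" by (simp only: one mod_sum_eq)
  also have "\<dots> = card {j \<in> J. q < j}"
  proof -
    have "card {j \<in> J. q < j} \<le> card J" using J(1) by (intro card_mono) auto
    then show ?thesis using J(3) by simp
  qed
  finally show ?thesis using d by simp
qed

section \<open>Timed and space-bounded execution\<close>

type_synonym mem = "nat \<Rightarrow> int"

definition bdd :: "int \<Rightarrow> mem \<Rightarrow> bool" where
  "bdd B m \<longleftrightarrow> (\<forall>a. \<bar>m a\<bar> \<le> B)"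

lemma bdd_upd: "bdd B m \<Longrightarrow> \<bar>v\<bar> \<le> B \<Longrightarrow> bdd B (m(a := v))"
  by (simp add: bdd_def)

lemma bdd_mono: "bdd B m \<Longrightarrow> B \<le> B' \<Longrightarrow> bdd B' m"
  by (auto simp: bdd_def intro: order_trans)

definition ex :: "instr \<Rightarrow> mem \<Rightarrow> mem" where
  "ex i m = snd (exec i (0, m))"

lemma ex_simps [simp]:
  "ex (LoadC i c) m = m(i := c)"
  "ex (Add i j k) m = m(i := m j + m k)"
  "ex (Sub i j k) m = m(i := m j - m k)"
  "ex (Mul i j k) m = m(i := m j * m k)"
  "ex (Div i j k) m = m(i := m j div m k)"
  "ex (Mod i j k) m = m(i := m j mod m k)"
  "ex (LoadI i j) m = m(i := m (nat (m j)))"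
  "ex (StoreI i j) m = m(nat (m i) := m j)"
  by (simp_all add: ex_def)

fun straight :: "int \<Rightarrow> instr \<Rightarrow> bool" where
  "straight B (LoadC i c) = (\<bar>c\<bar> \<le> B)"
| "straight B (Add i j k) = True"
| "straight B (Sub i j k) = True"
| "straight B (Mul i j k) = True"
| "straight B (Div i j k) = True"
| "straight B (Mod i j k) = True"
| "straight B (LoadI i j) = True"
| "straight B (StoreI i j) = True"
| "straight B _ = False"

lemma exec_straight: "straight B i \<Longrightarrow> exec i (pc, m) = (Suc pc, ex i m)"
  by (cases i) (auto simp: ex_def)

lemma straight_mono: "straight B i \<Longrightarrow> B \<le> B' \<Longrightarrow> straight B' i"
  by (cases i) auto

lemma abs_mod_le: "\<bar>a mod b\<bar> \<le> max \<bar>a\<bar> \<bar>b\<bar>" for a b :: int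
proof -
  consider "b = 0" | "b > 0" | "b < 0" by linarith
  then show ?thesis
  proof cases
    case 2
    then show ?thesis using pos_mod_bound[of b a] pos_mod_sign[of b a] by linarith
  next
    case 3
    then show ?thesis using neg_mod_bound[of b a] neg_mod_sign[of b a] by linarith
  qed simp
qed

lemma abs_div_le: "\<bar>a div b\<bar> \<le> \<bar>a\<bar>" for a b :: int
proof -
  have pos: "\<bar>a div b\<bar> \<le> \<bar>a\<bar>" if "0 < b" for a b :: int
    using that zdiv_mono2[of a 1 b] zdiv_mono2_neg[of a 1 b] pos_imp_zdiv_nonneg_iff[OF that, of a]
    by (cases "a < 0") auto
  consider "b = 0" | "b > 0" | "b < 0" by linarith
  then show ?thesis
  proof cases
    case 3
    then show ?thesis using pos[of "- b" "- a"] by simp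
  qed (use pos in auto)
qed

text \<open>Multiplication is the worst case; quotient and remainder never exceed their arguments in
  absolute value.\<close>

lemma bdd_ex:
  assumes "bdd B m" "straight B i" and B: "2 \<le> B"
  shows "bdd (B ^ 2) (ex i m)"
proof -
  have BB: "B \<le> B ^ 2" "2 * B \<le> B ^ 2" using B by (simp_all add: power2_eq_square)
  have m: "\<bar>m a\<bar> \<le> B" for a using assms(1) by (simp add: bdd_def)
  have m2: "bdd (B ^ 2) m" using assms(1) BB(1) by (rule bdd_mono)
  have add: "\<bar>m j + m k\<bar> \<le> B ^ 2" "\<bar>m j - m k\<bar> \<le> B ^ 2" for j k
    using m[of j] m[of k] BB by linarith+
  have "\<bar>m j\<bar> * \<bar>m k\<bar> \<le> B * B" for j k using m B by (intro mult_mono) auto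
  then have mul: "\<bar>m j * m k\<bar> \<le> B ^ 2" for j k by (simp add: abs_mult power2_eq_square)
  have dv: "\<bar>m j div m k\<bar> \<le> B ^ 2" for j k using abs_div_le[of "m j" "m k"] m[of j] BB by linarith
  have md: "\<bar>m j mod m k\<bar> \<le> B ^ 2" for j k
    using abs_mod_le[of "m j" "m k"] m[of j] m[of k] BB by linarith
  have id: "\<bar>m j\<bar> \<le> B ^ 2" for j using m[of j] BB by linarith
  show ?thesis using assms(2) BB by (cases i) (auto intro!: bdd_upd m2 add mul dv md id)
qed

definition trace :: "instr list \<Rightarrow> int \<Rightarrow> nat \<Rightarrow> config \<Rightarrow> config \<Rightarrow> bool" where
  "trace p B t c c' \<longleftrightarrow> (step p ^^ t) c = c' \<and> (\<forall>s\<le>t. bdd B (snd ((step p ^^ s) c)))"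

lemma trace_refl: "bdd B (snd c) \<Longrightarrow> trace p B 0 c c"
  by (simp add: trace_def)

lemma trace_trans:
  assumes "trace p B t c c'" "trace p B t' c' c''"
  shows "trace p B (t + t') c c''"
proof -
  have "(step p ^^ (t + t')) c = c''" using assms by (simp add: trace_def add.commute[of t] funpow_add)
  moreover have "bdd B (snd ((step p ^^ s) c))" if s: "s \<le> t + t'" for s
  proof (cases "s \<le> t")
    case False
    then have "(step p ^^ s) c = (step p ^^ (s - t)) c'"
      using assms(1) funpow_add[of "s - t" t "step p"] by (simp add: trace_def)
    then show ?thesis using assms(2) s by (simp add: trace_def)
  qed (use assms in \<open>simp add: trace_def\<close>)
  ultimately show ?thesis by (simp add: trace_def)
qed

lemma trace_step:
  assumes "bdd B m" "bdd B m'" "step p (pc, m) = (pc', m')"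
  shows "trace p B 1 (pc, m) (pc', m')"
  using assms by (auto simp: trace_def le_Suc_eq)

lemma trace_block:
  assumes "bdd B0 m" "2 \<le> B0" "list_all (straight B0) xs" "B0 ^ (2 ^ length xs) \<le> B"
  shows "trace (pre @ xs @ post) B (length xs) (length pre, m) (length pre + length xs, fold ex xs m)"
  using assms
proof (induction "xs" arbitrary: pre m B0)
  case Nil
  then have "bdd B m" by (auto intro: bdd_mono)
  then show ?case by (simp add: trace_refl)
next
  case (Cons i "xs")
  have sq: "B0 \<le> B0 ^ 2" using Cons.prems(2) by (simp add: power2_eq_square)
  have "bdd (B0 ^ 2) (ex i m)" using Cons.prems by (intro bdd_ex) auto
  moreover have "list_all (straight (B0 ^ 2)) xs"
    using Cons.prems(3) straight_mono[OF _ sq] by (auto simp: list_all_iff)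
  moreover have pw: "(B0 ^ 2) ^ (2 ^ length xs) \<le> B" using Cons.prems(4) by (simp add: power_mult)
  moreover have "2 \<le> B0 ^ 2" using sq Cons.prems(2) by linarith
  ultimately have tr: "trace ((pre @ [i]) @ xs @ post) B (length xs) (length (pre @ [i]), ex i m)
      (length (pre @ [i]) + length xs, fold ex xs (ex i m))" by (intro Cons.IH)
  have BB: "B0 ^ 2 \<le> B" using pw \<open>2 \<le> B0 ^ 2\<close> self_le_power[of "B0 ^ 2" "2 ^ length xs"] by simp
  have "trace (pre @ (i # xs) @ post) B 1 (length pre, m) (Suc (length pre), ex i m)"
    using Cons.prems bdd_mono[OF _ BB] sq \<open>bdd (B0 ^ 2) (ex i m)\<close> exec_straight[of B0 i]
    by (intro trace_step) (auto simp: step_def nth_append intro: bdd_mono)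
  from trace_trans[OF this, of "length xs"] tr show ?case by simp
qed

text \<open>A code fragment is a function of the address at which it is placed. The squaring bound of
  \<open>bdd_ex\<close> means that memory bounds are only needed at the heads of loops, as long as
  every block has at most 64 instructions.\<close>
type_synonym code = "nat \<Rightarrow> instr list"

definition cap :: "int \<Rightarrow> int" where
  "cap M = M ^ (2 ^ 64)"

text \<open>Total correctness with a time bound. Quantifying over \<open>pre\<close> and
  \<open>post\<close> makes it valid at every place in a program, although jump targets are
  absolute.\<close>

definition triple :: "int \<Rightarrow> (mem \<Rightarrow> bool) \<Rightarrow> code \<Rightarrow> nat \<Rightarrow> (mem \<Rightarrow> bool) \<Rightarrow> bool" where
  "triple M P c T Q \<longleftrightarrow> (\<forall>pre post m. P m \<longrightarrow> (\<exists>t\<le>T. \<exists>m'. Q m' \<and>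
     trace (pre @ c (length pre) @ post) (cap M) t
       (length pre, m) (length pre + length (c (length pre)), m')))"

definition block :: "instr list \<Rightarrow> code" where
  "block xs = (\<lambda>a. xs)"

definition while_pos :: "nat \<Rightarrow> instr list \<Rightarrow> code" where
  "while_pos r xs = (\<lambda>a. Jle0 r (a + length xs + 2) # xs @ [Jmp a])"

definition seqc :: "code \<Rightarrow> code \<Rightarrow> code" (infixr ";;" 60) where
  "c ;; d = (\<lambda>a. c a @ d (a + length (c a)))"

lemma triple_seq:
  assumes "triple M P c T Q" "triple M Q d T' R"
  shows "triple M P (c ;; d) (T + T') R"
  unfolding triple_def
proof (intro allI impI)
  fix pre post m assume "P m"
  then obtain t m' where 1: "t \<le> T" "Q m'" "trace (pre @ c (length pre) @ (d (length pre + length (c (length pre))) @ post)) (cap M) t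
       (length pre, m) (length pre + length (c (length pre)), m')"
    using assms(1) unfolding triple_def by blast
  define pre' where "pre' = pre @ c (length pre)"
  obtain t' m'' where 2: "t' \<le> T'" "R m''" "trace (pre' @ d (length pre') @ post) (cap M) t'
       (length pre', m') (length pre' + length (d (length pre')), m'')"
    using assms(2) 1(2) unfolding triple_def by blast
  have "trace (pre @ (c ;; d) (length pre) @ post) (cap M) (t + t') (length pre, m)
      (length pre + length ((c ;; d) (length pre)), m'')"
    using trace_trans[of _ _ t _ "(length pre', m')"] 1(3) 2(3) by (simp add: pre'_def seqc_def add.assoc)
  then show "\<exists>t\<le>T + T'. \<exists>m'. R m' \<and> trace (pre @ (c ;; d) (length pre) @ post) (cap M) t (length pre, m)
      (length pre + length ((c ;; d) (length pre)), m')"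
    using 1 2 by (meson add_mono)
qed

lemma triple_mono: "triple M P c T Q \<Longrightarrow> T \<le> T' \<Longrightarrow> triple M P c T' Q"
  unfolding triple_def by (meson order_trans)

lemma cap_block: "2 \<le> M \<Longrightarrow> length xs \<le> 64 \<Longrightarrow> M ^ (2 ^ length xs) \<le> cap M"
  unfolding cap_def by (intro power_increasing) auto

lemma triple_block:
  assumes "\<And>m. P m \<Longrightarrow> bdd M m \<and> Q (fold ex xs m)" "2 \<le> M" "list_all (straight M) xs" "length xs \<le> 64"
  shows "triple M P (block xs) (length xs) Q"
  unfolding triple_def block_def
  using trace_block[OF _ assms(2,3) cap_block[OF assms(2,4)]] assms(1) by blast

text \<open>The counter register equals the index of the invariant, so there are exactly
  \<open>K\<close> iterations, each with one test and one jump besides the body, and a final test.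
  The invariant restores the bound \<open>M\<close> at every loop head, so the squaring inside the
  body does not accumulate over iterations.\<close>

lemma triple_while:
  assumes inv: "\<And>k m. I k m \<Longrightarrow> bdd M m \<and> m r = int k"
    and body: "\<And>k m. I (Suc k) m \<Longrightarrow> I k (fold ex xs m)"
    and M: "2 \<le> M" "list_all (straight M) xs" "length xs \<le> 64"
  shows "triple M (I K) (while_pos r xs) (K * (length xs + 2) + 1) (I 0)"
  unfolding triple_def
proof (intro allI impI)
  fix pre post m assume I: "I K m"
  let ?p = "pre @ while_pos r xs (length pre) @ post"
  have ll: "M \<le> cap M" using cap_block[OF M(1), of "[]"] by simp
  have len: "length (while_pos r xs (length pre)) = length xs + 2" by (simp add: while_pos_def)
  have p0: "?p ! length pre = Jle0 r (length pre + length xs + 2)" by (simp add: while_pos_def)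
  have p1: "?p ! (length pre + length xs + 1) = Jmp (length pre)" by (simp add: while_pos_def nth_append)
  have lp: "length pre + length xs + 1 < length ?p" "length pre < length ?p" by (auto simp: len)
  have ex: "\<exists>m'. I 0 m' \<and> trace ?p (cap M) (k * (length xs + 2) + 1) (length pre, m)
      (length pre + length xs + 2, m')" if "I k m" for k m
    using that
  proof (induction k arbitrary: m)
    case 0
    then have "bdd (cap M) m" "m r = 0" using inv[of 0 m] bdd_mono[OF _ ll] by auto
    then have "trace ?p (cap M) 1 (length pre, m) (length pre + length xs + 2, m)"
      using lp p0 by (intro trace_step) (auto simp: step_def simp del: append_assoc)
    then show ?case using 0 by auto
  next
    case (Suc k)
    have b: "bdd M m" "m r = int (Suc k)" using inv[OF Suc.prems] by auto
    have b': "bdd (cap M) m" using bdd_mono[OF b(1) ll] .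
    have I': "I k (fold ex xs m)" using body[OF Suc.prems] .
    have b'': "bdd (cap M) (fold ex xs m)" using inv[OF I'] bdd_mono[OF _ ll] by blast
    have "trace ?p (cap M) 1 (length pre, m) (length pre + 1, m)"
      using lp p0 b b' by (intro trace_step) (auto simp: step_def simp del: append_assoc)
    moreover have "trace ?p (cap M) (length xs) (length pre + 1, m) (length pre + 1 + length xs, fold ex xs m)"
      using trace_block[OF b(1) M(1,2) cap_block[OF M(1,3)], of "pre @ [Jle0 r (length pre + length xs + 2)]" "Jmp (length pre) # post"]
      by (simp add: while_pos_def)
    moreover have "trace ?p (cap M) 1 (length pre + 1 + length xs, fold ex xs m) (length pre, fold ex xs m)"
      using lp p1 b'' by (intro trace_step) (auto simp: step_def simp del: append_assoc)
    moreover obtain m' where "I 0 m'" "trace ?p (cap M) (k * (length xs + 2) + 1) (length pre, fold ex xs m)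
      (length pre + length xs + 2, m')" using Suc.IH[OF I'] by auto
    ultimately have "trace ?p (cap M) (1 + length xs + 1 + (k * (length xs + 2) + 1)) (length pre, m)
      (length pre + length xs + 2, m')" by (blast intro: trace_trans)
    then show ?case using \<open>I 0 m'\<close> by (intro exI[of _ m']) (simp add: algebra_simps)
  qed
  then show "\<exists>t\<le>K * (length xs + 2) + 1. \<exists>m'. I 0 m' \<and> trace ?p (cap M) t (length pre, m)
      (length pre + length (while_pos r xs (length pre)), m')"
    using ex[OF I] len by (metis add.assoc order_refl)
qed

text \<open>In the square of the factorial, pair the factors \<open>Suc i\<close> and
  \<open>n - i\<close>: each product is at least \<open>n\<close>. This turns powers of n^n into
  powers of n!.\<close>

lemma power_self_le_fact_square: "n ^ n \<le> (fact n) ^ 2" for n :: nat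
proof -
  have "(fact n :: nat) ^ 2 = (\<Prod>i<n. Suc i) * (\<Prod>i<n. n - i)"
    using fact_prod_Suc[of n, where 'a = nat] fact_prod_rev[of n, where 'a = nat]
    by (simp add: power2_eq_square lessThan_atLeast0)
  also have "\<dots> = (\<Prod>i<n. Suc i * (n - i))" by (simp only: prod.distrib)
  also have "\<dots> \<ge> (\<Prod>i<n. n)"
  proof (rule prod_mono)
    fix i assume "i \<in> {..<n}"
    then obtain k where "n = i + Suc k" by (auto dest: less_imp_Suc_add)
    then show "0 \<le> n \<and> n \<le> Suc i * (n - i)" by simp
  qed
  finally show ?thesis by simp
qed

section \<open>The program\<close>

text \<open>Register 0 holds \<open>n\<close>. The first five entries of the input are packed into register 1
  to free registers 2 to 5. The tables are placed behind the input: the entries of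
  \<open>\<pi>\<close> at \<open>66 + 2n\<close>, the inverse of \<open>\<pi>\<close> at \<open>65 + n\<close>, the powers of
  \<open>n\<close> at \<open>67 + 3n\<close>, \<open>T_num\<close> at \<open>68 + 4n\<close>, \<open>U_num\<close> at
  \<open>69 + 5n\<close> and the positions \<open>jpos\<close> at \<open>70 + 6n\<close>.\<close>
definition A0 :: "instr list" where
  "A0 = [Mul 1 1 0, Add 1 1 2, Mul 1 1 0, Add 1 1 3, Mul 1 1 0, Add 1 1 4, Mul 1 1 0, Add 1 1 5,
    LoadC 3 5, Sub 2 0 3]"

lemma A0_exec:
  assumes "m 0 = int n"
  shows "fold ex A0 m = m(1 := (((m 1 * int n + m 2) * int n + m 3) * int n + m 4) * int n + m 5,
    3 := 5, 2 := int n - 5)"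
  using assms by (intro ext) (simp add: A0_def)

text \<open>Handles the entries from the last one down to the sixth. As long as input remains to be
  read, only registers 0 to 5 are work space.\<close>

definition A1 :: "instr list" where
  "A1 = [LoadC 3 5, Add 3 2 3, LoadI 4 3,
    LoadC 5 66, Add 5 5 0, Add 5 5 0, Add 5 5 3, StoreI 5 4,
    LoadC 5 65, Add 5 5 0, Add 5 5 4, StoreI 5 3, LoadC 3 1, Sub 2 2 3]"

lemma A1_exec:
  assumes "m 0 = int n" "m 2 = int (Suc k)" "m (6 + k) = int a"
  shows "fold ex A1 m = m(3 := 1, 4 := int a, 5 := int (65 + n + a), 2 := int k,
    66 + 2 * n + (k + 6) := int a, 65 + n + a := int (k + 6))"
  using assms by (intro ext) (simp add: A1_def nat_add_distrib nat_mult_distrib)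

definition A3 :: "instr list" where
  "A3 = [LoadC 4 1, Sub 1 1 4, Mod 3 1 0, Div 1 1 0, Add 3 3 4,
    LoadC 5 66, Add 5 5 0, Add 5 5 0, Add 5 5 2, StoreI 5 3,
    LoadC 5 65, Add 5 5 0, Add 5 5 3, StoreI 5 2, Sub 2 2 4]"

lemma A3_exec:
  assumes "m 0 = int n" "m 2 = int (Suc k)" "(m 1 - 1) mod int n = int a - 1" "(m 1 - 1) div int n = h"
  shows "fold ex A3 m = m(4 := 1, 3 := int a, 5 := int (65 + n + a), 1 := h, 2 := int k,
    66 + 2 * n + Suc k := int a, 65 + n + a := int (Suc k))"
  using assms by (intro ext) (simp add: A3_def nat_add_distrib nat_mult_distrib)

definition B0 :: "instr list" where
  "B0 = [LoadC 6 1, Sub 7 0 6, LoadC 1 65, Add 10 1 0, Add 2 0 6, Add 11 10 2, Add 12 11 2,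
    Add 13 12 2, Add 14 13 2, Add 15 14 2, LoadC 9 0, Add 8 0 9, LoadC 16 1, Add 17 0 9,
    LoadC 18 0, LoadC 19 0]"

lemma B0_exec:
  assumes "m 0 = int n"
  shows "fold ex B0 m = m(6 := 1, 7 := int n - 1, 1 := 65, 2 := int n + 1, 10 := int (65 + n),
    11 := int (66 + 2 * n), 12 := int (67 + 3 * n), 13 := int (68 + 4 * n), 14 := int (69 + 5 * n),
    15 := int (70 + 6 * n), 9 := 0, 8 := int n, 16 := 1, 17 := int n, 18 := 0, 19 := 0)"
  using assms by (intro ext) (simp add: B0_def)

definition B1 :: "instr list" where
  "B1 = [Add 1 12 9, StoreI 1 16, Add 1 13 9, StoreI 1 18, Add 1 14 9, StoreI 1 19,
    Mul 16 16 0, Sub 2 7 6, Sub 2 2 9, Mul 17 17 2, Add 18 18 17, Add 19 19 18,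
    Add 9 9 6, Sub 8 8 6]"

lemma B1_exec:
  assumes "m 0 = int n" "m 6 = 1" "m 7 = int N" "m 12 = int (67 + 3 * n)" "m 13 = int (68 + 4 * n)"
    "m 14 = int (69 + 5 * n)" "m 9 = int i" "m 8 = int (Suc k)"
  shows "fold ex B1 m = m(1 := int (69 + 5 * n + i), 2 := int N - 1 - int i,
    67 + 3 * n + i := m 16, 68 + 4 * n + i := m 18, 69 + 5 * n + i := m 19,
    16 := m 16 * int n, 17 := m 17 * (int N - 1 - int i), 18 := m 18 + m 17 * (int N - 1 - int i), 
    19 := m 19 + (m 18 + m 17 * (int N - 1 - int i)), 9 := int (Suc i), 8 := int k)"
  using assms by (intro ext) (simp add: B1_def nat_add_distrib nat_mult_distrib)

text \<open>Register 20 receives the position of the largest entry, 21 the entry cyclically after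
  it, which is the head of \<open>L\<close>, and 22 the difference of two neighbouring values of
  \<open>T_num\<close>, which is \<open>M_num\<close>. Register 23 encodes the empty set of moved
  positions.\<close>

definition C0 :: "instr list" where
  "C0 = [Add 1 10 0, LoadI 20 1, Mod 1 20 0, Add 1 1 6, Add 1 1 11, LoadI 21 1,
    Add 1 13 7, Sub 1 1 6, LoadI 22 1, Sub 1 1 6, LoadI 2 1, Sub 22 22 2,
    LoadC 9 0, Sub 8 7 6, LoadC 23 0]"

lemma C0_exec:
  assumes "m 0 = int n" "m 6 = 1" "m 7 = int (Suc (Suc j))" "m 10 = int (65 + n)"
    "m 11 = int (66 + 2 * n)" "m 13 = int (68 + 4 * n)"
    "m (2 * n + 65) = int P" "m (67 + (P mod n + 2 * n)) = int d"
    "m (69 + (4 * n + j)) = t1" "m (68 + (4 * n + j)) = t2"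
  shows "fold ex C0 m = m(1 := int (68 + 4 * n + j), 2 := t2, 20 := int P, 21 := int d, 22 := t1 - t2,
    9 := 0, 8 := int (Suc j), 23 := 0)"
proof -
  have "int P mod int n = int (P mod n)" by (simp add: zmod_int)
  then show ?thesis
    using assms by (intro ext) (simp add: C0_def nat_add_distrib nat_mult_distrib)
qed

text \<open>The original position in \<open>L\<close> of the entry moved in this step: its cyclic
  distance from the largest entry, less one.\<close>

definition C1a :: "instr list" where
  "C1a = [Add 1 21 9, Mod 1 1 7, Add 1 1 6, Add 1 1 10, LoadI 2 1, Sub 2 2 20, Sub 2 2 6, Mod 2 2 0]"

definition C1b :: "instr list" where
  "C1b = [Add 1 12 2, LoadI 3 1, Div 4 23 3, Mod 4 4 7, Add 4 4 2, Add 1 15 9, StoreI 1 4,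
    Add 23 23 3, Add 9 9 6, Sub 8 8 6]"

lemma C1a_exec:
  assumes "m 0 = int n" "m 6 = 1" "m 7 = int N" "m 10 = int (65 + n)" "m 21 = int d" "m 9 = int s"
    "m (65 + n + Suc ((d + s) mod N)) = iv"
  shows "fold ex C1a m = m(1 := int (65 + n + Suc ((d + s) mod N)), 2 := (iv - m 20 - 1) mod int n)"
proof -
  have "(m 21 + m 9) mod m 7 + m 6 + m 10 = int (65 + n + Suc ((d + s) mod N))"
    using assms by (simp add: zmod_int)
  moreover have "nat (int (65 + n + Suc ((d + s) mod N))) = 65 + n + Suc ((d + s) mod N)" by simp
  ultimately show ?thesis
    using assms(1,2,6,7)
    by (intro ext) (simp add: C1a_def del: of_nat_add of_nat_Suc add_Suc_right)
qed

lemma C1b_exec: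
  assumes "m 6 = 1" "m 7 = int N" "m 12 = int (67 + 3 * n)"
    "m 15 = int (70 + 6 * n)" "m 9 = int s" "m 8 = int (Suc k)" "m 2 = int q"
    "m (67 + 3 * n + q) = w" "m 23 div w mod int N + int q = int p"
  shows "fold ex C1b m = m(1 := int (70 + 6 * n + s), 3 := w, 4 := int p,
    70 + 6 * n + s := int p, 23 := m 23 + w, 9 := int (Suc s), 8 := int k)"
  using assms by (intro ext) (simp add: C1b_def nat_add_distrib nat_mult_distrib)

text \<open>The state on the spine: complete run and flag 1. The 0 in register 26 is a placeholder,
  because the flag selects the closed form.\<close>

definition D0 :: "instr list" where
  "D0 = [LoadC 25 1, Sub 8 7 6, Add 24 8 6, LoadC 26 0]"

lemma D0_exec:
  assumes "m 6 = 1" "m 7 = int (Suc j)"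
  shows "fold ex D0 m = m(25 := 1, 8 := int j, 24 := int (Suc j), 26 := 0)"
  using assms by (intro ext) (simp add: D0_def)

text \<open>Loop bodies are straight-line, so case distinctions are arithmetic: with the flag
  \<open>f\<close> in register 25, \<open>y + (z - y) * f\<close> chooses between the parent value
  \<open>y\<close> and the spine formula \<open>z\<close>.\<close>

definition D1a :: "instr list" where
  "D1a = [Sub 8 8 6, Add 1 21 8, Mod 1 1 7, Add 1 1 6, LoadC 2 2, Sub 3 22 2, Mul 3 3 1,
    Add 3 3 7, Add 3 3 7, Sub 3 3 26, Mul 3 3 25, Add 3 26 3, Add 1 15 8, LoadI 4 1]"

text \<open>For a position \<open>p\<close> and a parent run \<open>u\<close>,
  \<open>(p + 1) div N\<close> is 1 exactly if \<open>p = N - 1\<close>, and for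
  \<open>d = p - (u - 1)\<close> the quotient \<open>d div N\<close> is 0 or -1 according to the
  sign of \<open>d\<close>. Hence \<open>u - 1 - d * (d div N)\<close> is the minimum of
  \<open>p\<close> and \<open>u - 1\<close>.\<close>

definition D1b :: "instr list" where
  "D1b = [Add 1 4 6, Div 1 1 7, Mul 25 25 1, Sub 24 24 6, Sub 1 4 24, Div 2 1 7, Mul 1 1 2, Sub 24 24 1]"

definition D1c :: "instr list" where
  "D1c = [Sub 1 24 6, Add 2 13 1, LoadI 5 2, Add 2 14 1, LoadI 2 2, Sub 26 3 2,
    Sub 1 4 24, Sub 1 1 6, Mul 1 1 5, Sub 26 26 1, Add 1 0 6, Mul 1 1 4, Sub 26 26 1, Add 26 26 0,
    Add 24 24 25, LoadC 3 0]"

lemma D1a_exec: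
  assumes "m 6 = 1" "m 7 = int N" "m 8 = int (Suc s)" "m 15 = int (70 + 6 * n)" "m 21 = int d"
    "m (70 + 6 * n + s) = q"
  shows "fold ex D1a m = m(8 := int s, 1 := int (70 + 6 * n + s), 2 := 2, 4 := q,
    3 := m 26 + ((m 22 - 2) * (int ((d + s) mod N) + 1) + int N + int N - m 26) * m 25)"
proof -
  have "(int d + int s) mod int N = int ((d + s) mod N)" by (simp add: zmod_int)
  then show ?thesis
    using assms by (intro ext) (simp add: D1a_def nat_add_distrib nat_mult_distrib)
qed

lemma D1b_exec:
  assumes "m 6 = 1"
  shows "fold ex D1b m = m(25 := m 25 * ((m 4 + 1) div m 7), 2 := (m 4 - (m 24 - 1)) div m 7,
    1 := (m 4 - (m 24 - 1)) * ((m 4 - (m 24 - 1)) div m 7),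
    24 := m 24 - 1 - (m 4 - (m 24 - 1)) * ((m 4 - (m 24 - 1)) div m 7))"
  using assms by (intro ext) (simp add: D1b_def)

lemma D1c_exec:
  assumes "m 0 = int n" "m 6 = 1" "m 13 = int (68 + 4 * n)" "m 14 = int (69 + 5 * n)" "m 24 = int (Suc r)"
    "m (68 + 4 * n + r) = t" "m (69 + 5 * n + r) = u"
  shows "fold ex D1c m = m(1 := (int n + 1) * m 4, 2 := u, 3 := 0, 5 := t,
    26 := m 3 - u - (m 4 - int (Suc r) - 1) * t - (int n + 1) * m 4 + int n,
    24 := int (Suc r) + m 25)"
  using assms by (intro ext) (simp add: D1c_def nat_add_distrib nat_mult_distrib)

text \<open>On the spine the \<open>T_num\<close> entry read first has the valid index
  \<open>N - 2\<close> and is discarded through the flag. The quotient of \<open>c - jpos\<close> by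
  n, plus 1, is the indicator of \<open>jpos \<le> c\<close>.\<close>

definition E0 :: "instr list" where
  "E0 = [Sub 1 24 25, Sub 1 1 6, Add 1 1 13, LoadI 5 1, Mod 1 21 7, Mul 1 1 22, Sub 1 1 5,
    Mul 1 1 25, Add 5 5 1, Add 5 5 0, Sub 1 0 20, LoadI 2 15, Sub 2 1 2, Div 2 2 0, Add 2 2 6,
    Mul 5 5 2, Add 26 26 1, Sub 0 26 5]"

lemma E0_exec:
  assumes "m 0 = int n" "m 6 = 1" "m 7 = int N" "m 13 = int (68 + 4 * n)" "m 15 = int (70 + 6 * n)"
    "m 24 - m 25 - 1 = int r" "m 20 = int n - int c" "m 21 = int d"
    "m (68 + (4 * n + r)) = t" "m (70 + 6 * n) = p"
  shows "fold ex E0 m 0 = m 26 + int c - (t + (int (d mod N) * m 22 - t) * m 25 + int n) * ((int c - p) div int n + 1)"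
proof -
  have "m 24 - m 25 - 1 + int (68 + 4 * n) = int (68 + (4 * n + r))" using assms(6) by simp
  then have "nat (m 24 - m 25 - 1 + int (68 + 4 * n)) = 68 + (4 * n + r)" by (simp only: nat_int)
  moreover have "int d mod int N = int (d mod N)" by (simp add: zmod_int)
  moreover have "nat (int (70 + 6 * n)) = 70 + 6 * n" by simp
  ultimately show ?thesis
    using assms(1-5,7-) by (simp add: E0_def del: of_nat_add)
qed

definition ranking_code :: code where
  "ranking_code = block A0 ;; while_pos 2 A1 ;; block [LoadC 2 5] ;; while_pos 2 A3 ;;
    block B0 ;; while_pos 8 B1 ;; block C0 ;; while_pos 8 (C1a @ C1b) ;;
    block D0 ;; while_pos 8 (D1a @ D1b @ D1c) ;; block E0"

section \<open>Correctness of the program\<close>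

lemma div_eq_minus_one: "- b \<le> a \<Longrightarrow> a < 0 \<Longrightarrow> a div b = - 1" for a b :: int
  by (rule int_div_pos_eq[of _ _ _ "a + b"]) auto

locale ranking_input =
  fixes N :: nat and L :: "nat list" and c :: nat
  assumes N4: "4 \<le> N" and P: "is_nperm N L" and c: "c \<le> N"
begin

definition n :: nat where "n = Suc N"
text \<open>Room for every register at a loop head: the largest exponents that occur are
  \<open>n + 3\<close> for tables and values and 10 for the five packed entries, both at most
  \<open>2 * n\<close> once n \<ge> 5.\<close>

definition M :: int where "M = int n ^ (2 * n)"
definition \<pi> :: "nat list" where "\<pi> = mk L c"

lemma N3: "3 \<le> N" using N4 by simp

lemma n5: "5 \<le> n" using N4 by (simp add: n_def)

lemma powM: "k \<le> 2 * n \<Longrightarrow> \<bar>x\<bar> \<le> int n ^ k \<Longrightarrow> \<bar>x\<bar> \<le> M"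
  unfolding M_def using n5 power_increasing[of k "2 * n" "int n"] by linarith

lemma smallM: "a \<le> 100 + 10 * n \<Longrightarrow> \<bar>int a\<bar> \<le> M"
proof (rule powM[of 4])
  assume "a \<le> 100 + 10 * n"
  moreover have "100 + 10 * n \<le> 5 ^ 3 * n" using n5 by simp
  moreover have "5 ^ 3 * n \<le> n ^ 3 * n" using n5 by (intro mult_right_mono power_mono) auto
  moreover have "n ^ 3 * n = n ^ 4" by (simp add: eval_nat_numeral)
  ultimately have "a \<le> n ^ 4" by linarith
  then show "\<bar>int a\<bar> \<le> int n ^ 4" by (metis abs_of_nat of_nat_le_iff of_nat_power)
qed (use n5 in simp)

lemma bigM: "100 + 10 * int n \<le> M" using smallM[of "100 + 10 * n"] by simp

lemma M100: "100 \<le> M" using smallM[of 100] by simp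

lemma M2: "2 \<le> M" using M100 by simp

lemma perm: "is_nperm n \<pi>"
  using mk_nperm[OF P c] by (simp add: n_def \<pi>_def)

lemma len: "length \<pi> = n" "length L = N"
  using is_nperm_length[OF perm] is_nperm_length[OF P] by auto

lemma entry: "i < n \<Longrightarrow> 1 \<le> \<pi> ! i \<and> \<pi> ! i \<le> n"
  using perm len nth_mem[of i \<pi>] by (auto simp: is_nperm_def)

lemma entry_eq: "i < n \<Longrightarrow> j < n \<Longrightarrow> \<pi> ! i = \<pi> ! j \<longleftrightarrow> i = j"
  using perm len nth_eq_iff_index_eq[of \<pi> i j] by (auto simp: is_nperm_def)

lemma nth_pi: "i < n \<Longrightarrow> \<pi> ! i = (if i < N - c then L ! (c + i) else if i = N - c then n else L ! (i - (N - c) - 1))"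
  using len c by (auto simp: \<pi>_def mk_def nth_append nth_Cons' n_def)

lemma pos_max: "\<pi> ! (N - c) = n"
  using nth_pi[of "N - c"] by (simp add: n_def)

lemma pos_hd: "\<pi> ! ((n - c) mod n) = hd L"
proof -
  have hd: "hd L = L ! 0" using len N4 by (intro hd_conv_nth) auto
  show ?thesis
  proof (cases "c = 0")
    case True
    then show ?thesis using nth_pi[of 0] hd N4 by (simp add: n_def)
  next
    case False
    then have "(n - c) mod n = n - c" "n - c < n" "n - c = Suc (N - c)" using c by (auto simp: n_def)
    then show ?thesis using nth_pi[of "n - c"] hd by simp
  qed
qed

text \<open>Positions are 1-based and the largest entry stands at \<open>n - c\<close>; reduction
  modulo \<open>n\<close> treats the entries before and behind it uniformly.\<close>

lemma pos_val:
  assumes v: "v \<in> {1..N}"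
  obtains i where "i < n" "\<pi> ! i = v" "(int (Suc i) - int (n - c) - 1) mod int n = int (ipos v L)"
proof -
  define j where "j = ipos v L"
  have vL: "v \<in> set L" using P v by (auto simp: is_nperm_def)
  have j: "j < N" "L ! j = v" using nth_ipos[OF vL] len by (auto simp: j_def)
  show thesis
  proof (cases "c \<le> j")
    case True
    have "(int (Suc (j - c)) - int (n - c) - 1) = int j - int n" using True c by (simp add: n_def)
    moreover have "(int j - int n) mod int n = int j" unfolding minus_mod_self2 using j(1) by (simp add: n_def)
    ultimately have "(int (Suc (j - c)) - int (n - c) - 1) mod int n = int j" by (simp only:)
    moreover have "j - c < n" "\<pi> ! (j - c) = v" using nth_pi[of "j - c"] True j by (auto simp: n_def)
    ultimately show thesis using that[of "j - c"] by (simp add: j_def)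
  next
    case False
    have "(int (Suc (N - c + 1 + j)) - int (n - c) - 1) = int j" using c by (simp add: n_def)
    moreover have "int j mod int n = int j" using j(1) by (simp add: n_def)
    ultimately have "(int (Suc (N - c + 1 + j)) - int (n - c) - 1) mod int n = int j" by (simp only:)
    moreover have "N - c + 1 + j < n" using False c by (simp add: n_def)
    moreover from this have "\<pi> ! (N - c + 1 + j) = v" using nth_pi[of "N - c + 1 + j"] j by simp
    ultimately show thesis using that[of "N - c + 1 + j"] by (simp add: j_def)
  qed
qed

section \<open>Invariants for copying the input and for the numerical tables\<close>

fun packed :: "nat \<Rightarrow> int" where
  "packed 0 = 0"
| "packed (Suc k) = packed k * int n + int (\<pi> ! k)"

lemma packed_bounds: "k \<le> n \<Longrightarrow> 0 \<le> packed k \<and> packed k \<le> int n ^ (2 * k)"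
proof (induction k)
  case (Suc k)
  then have IH: "0 \<le> packed k" "packed k \<le> int n ^ (2 * k)" by auto
  have a: "int (\<pi> ! k) \<le> int n" using entry[of k] Suc.prems by simp
  have "packed k * int n \<le> int n ^ (2 * k) * int n" using IH by (intro mult_right_mono) auto
  moreover have "1 * int n \<le> int n ^ (2 * k) * int n" using n5 by (intro mult_right_mono one_le_power) auto
  ultimately have "packed (Suc k) \<le> 2 * (int n ^ (2 * k) * int n)" using a by simp
  also have "\<dots> \<le> int n * (int n ^ (2 * k) * int n)" using n5 by (intro mult_right_mono) auto
  also have "\<dots> = int n ^ (2 * Suc k)" by (simp add: mult.commute)
  finally show ?case using IH by simp
qed simp

definition tab :: "nat \<Rightarrow> mem \<Rightarrow> bool" where
  "tab k m \<longleftrightarrow> (\<forall>i. k \<le> i \<and> i < n \<longrightarrow>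
    m (66 + 2 * n + Suc i) = int (\<pi> ! i) \<and> m (65 + n + \<pi> ! i) = int (Suc i))"

lemma tab_step:
  assumes "tab (Suc k) m" "k < n"
    and "m' (66 + 2 * n + Suc k) = int (\<pi> ! k)" "m' (65 + n + \<pi> ! k) = int (Suc k)"
    and "\<And>a. 64 < a \<Longrightarrow> a \<noteq> 66 + 2 * n + Suc k \<Longrightarrow> a \<noteq> 65 + n + \<pi> ! k \<Longrightarrow> m' a = m a"
  shows "tab k m'"
  unfolding tab_def
proof (intro allI impI)
  fix i assume i: "k \<le> i \<and> i < n"
  show "m' (66 + 2 * n + Suc i) = int (\<pi> ! i) \<and> m' (65 + n + \<pi> ! i) = int (Suc i)"
  proof (cases "i = k")
    case False
    then have "m' (66 + 2 * n + Suc i) = m (66 + 2 * n + Suc i)" "m' (65 + n + \<pi> ! i) = m (65 + n + \<pi> ! i)"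
      using i assms(2) entry[of i] entry[of k] entry_eq[of i k] by (auto intro!: assms(5))
    then show ?thesis using assms(1) i False by (auto simp: tab_def)
  qed (use assms in auto)
qed

lemma tab_frame:
  assumes "tab k m" "\<And>a. 65 + n \<le> a \<Longrightarrow> a < 67 + 3 * n \<Longrightarrow> m' a = m a"
  shows "tab k m'"
  unfolding tab_def
proof (intro allI impI)
  fix i assume i: "k \<le> i \<and> i < n"
  have "m' (66 + 2 * n + Suc i) = m (66 + 2 * n + Suc i)" "m' (65 + n + \<pi> ! i) = m (65 + n + \<pi> ! i)"
    using i entry[of i] by (auto intro!: assms(2))
  then show "m' (66 + 2 * n + Suc i) = int (\<pi> ! i) \<and> m' (65 + n + \<pi> ! i) = int (Suc i)"
    using assms(1) i by (simp add: tab_def)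
qed

definition I0 :: "mem \<Rightarrow> bool" where
  "I0 m \<longleftrightarrow> m = snd (init_config \<pi>)"

definition I1 :: "nat \<Rightarrow> mem \<Rightarrow> bool" where
  "I1 k m \<longleftrightarrow> bdd M m \<and> k + 5 \<le> n \<and> m 0 = int n \<and> m 1 = packed 5 \<and> m 2 = int k
    \<and> (\<forall>i. 5 \<le> i \<and> i < k + 5 \<longrightarrow> m (Suc i) = int (\<pi> ! i)) \<and> tab (k + 5) m"

definition I2 :: "nat \<Rightarrow> mem \<Rightarrow> bool" where
  "I2 k m \<longleftrightarrow> bdd M m \<and> k \<le> 5 \<and> m 0 = int n \<and> m 1 = packed k \<and> m 2 = int k \<and> tab k m"

lemma I0_facts: "I0 m \<Longrightarrow> m 0 = int n \<and> bdd M m \<and> (\<forall>i<n. m (Suc i) = int (\<pi> ! i))"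
proof -
  assume I: "I0 m"
  have "\<bar>m a\<bar> \<le> M" for a
  proof (cases "1 \<le> a \<and> a \<le> n")
    case True
    then have "m a = int (\<pi> ! (a - 1))" using I len(1) by (simp add: I0_def init_config_def)
    moreover have "a - 1 < n" using True by linarith
    then have "\<pi> ! (a - 1) \<le> n" using entry by blast
    ultimately show ?thesis using bigM by simp
  next
    case False
    then have "m a = int n \<or> m a = 0" using I len(1) by (auto simp: I0_def init_config_def)
    then show ?thesis using bigM by auto
  qed
  then show ?thesis using I len(1) by (auto simp: I0_def init_config_def bdd_def)
qed

lemma A0_post: "I0 m \<Longrightarrow> I1 (n - 5) (fold ex A0 m)"
proof -
  assume I: "I0 m"
  have f: "m 0 = int n" "bdd M m" "\<And>i. i < n \<Longrightarrow> m (Suc i) = int (\<pi> ! i)" using I0_facts[OF I] by auto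
  have r: "m 1 = int (\<pi> ! 0)" "m 2 = int (\<pi> ! 1)" "m 3 = int (\<pi> ! 2)" "m 4 = int (\<pi> ! 3)" "m 5 = int (\<pi> ! 4)"
    using f(3)[of 0] f(3)[of 1] f(3)[of 2] f(3)[of 3] f(3)[of 4] n5 by (simp_all add: eval_nat_numeral)
  have p: "(((m 1 * int n + m 2) * int n + m 3) * int n + m 4) * int n + m 5 = packed 5"
    unfolding r by (simp add: eval_nat_numeral)
  have m': "fold ex A0 m = m(1 := packed 5, 3 := 5, 2 := int (n - 5))"
    using A0_exec[of m n, OF f(1)] n5 unfolding p by (simp add: of_nat_diff)
  have "\<bar>packed 5\<bar> \<le> M" using packed_bounds[of 5] n5 by (intro powM[of "2 * 5"]) auto
  then have "bdd M (fold ex A0 m)" unfolding m'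
    using f(2) smallM[of 5] smallM[of "n - 5"] by (intro bdd_upd) simp_all
  moreover have "tab n (fold ex A0 m)" by (simp add: tab_def)
  ultimately show ?thesis using f n5 unfolding I1_def by (auto simp: m')
qed

lemma A1_step: "I1 (Suc k) m \<Longrightarrow> I1 k (fold ex A1 m)"
proof -
  assume I: "I1 (Suc k) m"
  define i where "i = k + 5"
  have i: "i < n" using I by (simp add: I1_def i_def)
  have all: "\<forall>i. 5 \<le> i \<and> i < Suc k + 5 \<longrightarrow> m (Suc i) = int (\<pi> ! i)" using I unfolding I1_def by blast
  have "5 \<le> i \<and> i < Suc k + 5" by (simp add: i_def)
  then have "m (Suc i) = int (\<pi> ! i)" using all by blast
  then have a: "m (6 + k) = int (\<pi> ! i)" by (simp add: i_def)
  have m': "fold ex A1 m = m(3 := 1, 4 := int (\<pi> ! i), 5 := int (65 + n + \<pi> ! i), 2 := int k,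
    66 + 2 * n + Suc i := int (\<pi> ! i), 65 + n + \<pi> ! i := int (Suc i))"
  proof -
    have k6: "k + 6 = Suc i" by (simp add: i_def)
    have "m 0 = int n" "m 2 = int (Suc k)" using I by (auto simp: I1_def)
    from A1_exec[of m n k "\<pi> ! i", OF this a] show ?thesis unfolding k6 .
  qed
  have "bdd M (fold ex A1 m)" unfolding m'
    using I bigM entry[OF i] i by (intro bdd_upd) (auto simp: I1_def i_def)
  moreover have "tab i (fold ex A1 m)"
    using I i entry[OF i] by (intro tab_step[of i m]) (auto simp: I1_def i_def m')
  ultimately show ?thesis using I unfolding I1_def by (auto simp: m' i_def)
qed

lemma A2_post: "I1 0 m \<Longrightarrow> I2 5 (fold ex [LoadC 2 5] m)"
  using smallM[of 5] by (auto simp: I1_def I2_def intro!: bdd_upd elim!: tab_frame)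

lemma A3_step: "I2 (Suc k) m \<Longrightarrow> I2 k (fold ex A3 m)"
proof -
  assume I: "I2 (Suc k) m"
  then have k: "k < n" "k \<le> 5" using n5 by (auto simp: I2_def)
  have e: "1 \<le> \<pi> ! k" "\<pi> ! k \<le> n" using entry[OF k(1)] by auto
  have m1: "m 1 - 1 = (int (\<pi> ! k) - 1) + packed k * int n" using I by (simp add: I2_def)
  have dm: "(m 1 - 1) mod int n = int (\<pi> ! k) - 1" "(m 1 - 1) div int n = packed k"
    unfolding m1 using e n5 by simp_all
  have m': "fold ex A3 m = m(4 := 1, 3 := int (\<pi> ! k), 5 := int (65 + n + \<pi> ! k), 1 := packed k,
    2 := int k, 66 + 2 * n + Suc k := int (\<pi> ! k), 65 + n + \<pi> ! k := int (Suc k))"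
    using A3_exec[of m n k "\<pi> ! k" "packed k", OF _ _ dm] I by (simp add: I2_def)
  have "\<bar>packed k\<bar> \<le> M" using packed_bounds[of k] k by (intro powM[of "2 * k"]) auto
  then have "bdd M (fold ex A3 m)" unfolding m'
    using I bigM e k by (intro bdd_upd) (auto simp: I2_def)
  moreover have "tab k (fold ex A3 m)"
    using I k e by (intro tab_step[of k m]) (auto simp: I2_def m')
  ultimately show ?thesis using I k unfolding I2_def by (auto simp: m')
qed

definition base :: "mem \<Rightarrow> bool" where
  "base m \<longleftrightarrow> m 0 = int n \<and> m 6 = 1 \<and> m 7 = int N \<and> m 10 = int (65 + n) \<and> m 11 = int (66 + 2 * n)
    \<and> m 12 = int (67 + 3 * n) \<and> m 13 = int (68 + 4 * n) \<and> m 14 = int (69 + 5 * n)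
    \<and> m 15 = int (70 + 6 * n) \<and> tab 0 m"

definition tables :: "nat \<Rightarrow> mem \<Rightarrow> bool" where
  "tables k m \<longleftrightarrow> (\<forall>i<k. m (67 + 3 * n + i) = int n ^ i \<and> m (68 + 4 * n + i) = T_num N i
     \<and> m (69 + 5 * n + i) = U_num N i)"

definition I3 :: "nat \<Rightarrow> mem \<Rightarrow> bool" where
  "I3 k m \<longleftrightarrow> bdd M m \<and> base m \<and> k \<le> n \<and> m 8 = int k \<and> m 9 = int (n - k) \<and> m 16 = int n ^ (n - k)
    \<and> m 17 = e_num N (n - k) \<and> m 18 = T_num N (n - k) \<and> m 19 = U_num N (n - k) \<and> tables (n - k) m"

lemma table_bounds:
  assumes "i \<le> n"
  shows "\<bar>int n ^ i\<bar> \<le> M" "\<bar>e_num N i\<bar> \<le> M" "\<bar>T_num N i\<bar> \<le> M" "\<bar>U_num N i\<bar> \<le> M"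
proof -
  show "\<bar>int n ^ i\<bar> \<le> M" using assms by (intro powM[of i]) auto
  show "\<bar>e_num N i\<bar> \<le> M" using assms e_num_bounds[of N i] N4 by (intro powM[of "i + 1"]) (auto simp: n_def)
  show "\<bar>T_num N i\<bar> \<le> M" using assms T_num_bounds[of N i] N4 by (intro powM[of "i + 2"]) (auto simp: n_def)
  show "\<bar>U_num N i\<bar> \<le> M" using assms U_num_bounds[of N i] N4 by (intro powM[of "i + 3"]) (auto simp: n_def)
qed

lemma B0_post: "I2 0 m \<Longrightarrow> I3 n (fold ex B0 m)"
proof -
  assume I: "I2 0 m"
  have m': "fold ex B0 m = m(6 := 1, 7 := int N, 1 := 65, 2 := int n + 1, 10 := int (65 + n),
    11 := int (66 + 2 * n), 12 := int (67 + 3 * n), 13 := int (68 + 4 * n), 14 := int (69 + 5 * n),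
    15 := int (70 + 6 * n), 9 := 0, 8 := int n, 16 := 1, 17 := int n, 18 := 0, 19 := 0)"
    using B0_exec[of m n] I by (simp add: I2_def n_def)
  have "bdd M (fold ex B0 m)" unfolding m'
    using I bigM by (intro bdd_upd) (auto simp: I2_def n_def)
  moreover have "tab 0 (fold ex B0 m)"
  proof (rule tab_frame)
    show "tab 0 m" using I by (simp add: I2_def)
  qed (simp add: m')
  ultimately show ?thesis using I by (simp add: I3_def base_def tables_def m' I2_def n_def)
qed

lemma B1_step: "I3 (Suc k) m \<Longrightarrow> I3 k (fold ex B1 m)"
proof -
  assume I: "I3 (Suc k) m"
  define i where "i = n - Suc k"
  have i: "i < n" "n - k = Suc i" using I by (auto simp: I3_def i_def)
  have b: "base m" "m 8 = int (Suc k)" "m 9 = int i" "tables i m" using I by (auto simp: I3_def i_def)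
  have v: "m 16 = int n ^ i" "m 17 = e_num N i" "m 18 = T_num N i" "m 19 = U_num N i"
    using I by (auto simp: I3_def i_def)
  have e: "m 17 * (int N - 1 - int i) = e_num N (Suc i)" by (simp add: v e_num.simps(2))
  have t: "m 18 + e_num N (Suc i) = T_num N (Suc i)" by (simp add: v T_num.simps(2))
  have u: "m 19 + T_num N (Suc i) = U_num N (Suc i)" by (simp add: v U_num.simps(2))
  have m': "fold ex B1 m = m(1 := int (69 + 5 * n + i), 2 := int N - 1 - int i,
    67 + 3 * n + i := int n ^ i, 68 + 4 * n + i := T_num N i, 69 + 5 * n + i := U_num N i,
    16 := int n ^ Suc i, 17 := e_num N (Suc i), 18 := T_num N (Suc i), 19 := U_num N (Suc i),
    9 := int (Suc i), 8 := int k)"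
  proof -
    have w: "m 16 * int n = int n ^ Suc i" by (simp add: v)
    have "fold ex B1 m = m(1 := int (69 + 5 * n + i), 2 := int N - 1 - int i,
      67 + 3 * n + i := m 16, 68 + 4 * n + i := m 18, 69 + 5 * n + i := m 19,
      16 := m 16 * int n, 17 := m 17 * (int N - 1 - int i), 18 := m 18 + m 17 * (int N - 1 - int i),
      19 := m 19 + (m 18 + m 17 * (int N - 1 - int i)), 9 := int (Suc i), 8 := int k)"
      using b by (intro B1_exec) (simp_all add: base_def)
    from this[unfolded e, unfolded t, unfolded u w, unfolded v] show ?thesis .
  qed
  have neg: "\<bar>int N - 1 - int i\<bar> \<le> M" using i smallM[of n] by (simp add: n_def)
  have "bdd M (fold ex B1 m)" unfolding m'
  proof (intro bdd_upd)
    show "bdd M m" using I by (simp add: I3_def)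
  qed (use i table_bounds[of i] table_bounds[of "Suc i"] neg bigM I in \<open>simp_all add: I3_def\<close>)
  moreover have "tab 0 (fold ex B1 m)"
  proof (rule tab_frame)
    show "tab 0 m" using b by (simp add: base_def)
  qed (use i in \<open>simp add: m'\<close>)
  moreover have "tables (Suc i) (fold ex B1 m)"
    using b(4) i(1) by (auto simp: tables_def m' less_Suc_eq)
  ultimately show ?thesis using I b i unfolding I3_def base_def by (auto simp: m')
qed

section \<open>Invariant for the positions along the chain of parents\<close>

definition base2 :: "mem \<Rightarrow> bool" where
  "base2 m \<longleftrightarrow> base m \<and> tables n m \<and> m 20 = int (n - c) \<and> m 21 = int (hd L) \<and> m 22 = M_num N"

definition ups :: "nat \<Rightarrow> nat list" where
  "ups s = (up N ^^ s) L"

definition I4 :: "nat \<Rightarrow> mem \<Rightarrow> bool" where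
  "I4 k m \<longleftrightarrow> bdd M m \<and> base2 m \<and> k \<le> N - 1 \<and> m 8 = int k \<and> m 9 = int (N - 1 - k)
    \<and> m 23 = (\<Sum>j\<in>moved N L (N - 1 - k). int n ^ j)
    \<and> (\<forall>s<N - 1 - k. m (70 + 6 * n + s) = int (jpos N (ups s)))"

lemma tables_frame:
  assumes "tables k m" "\<And>a. 67 + 3 * n \<le> a \<Longrightarrow> a < 70 + 6 * n \<Longrightarrow> m' a = m a" "k \<le> n"
  shows "tables k m'"
  using assms unfolding tables_def by auto

lemma C0_post: "I3 0 m \<Longrightarrow> I4 (N - 1) (fold ex C0 m)"
proof -
  assume I: "I3 0 m"
  have "N = Suc (Suc (N - 2))" using N4 by simp
  then obtain j where j: "N = Suc (Suc j)" by blast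
  then have jn: "Suc j < n" "j < n" "N - 1 = Suc j" "N - 2 = j" "int (Suc (Suc j)) = int N"
    unfolding n_def by simp_all
  have b: "base m" "tables n m" "bdd M m" using I by (auto simp: I3_def)
  have t: "m (68 + 4 * n + Suc j) = T_num N (Suc j)" "m (68 + 4 * n + j) = T_num N j"
    using b(2) jn(1,2) unfolding tables_def by blast+
  have p1: "m (65 + n + n) = int (n - c)"
    using b(1) pos_max c by (auto simp: base_def tab_def n_def dest!: spec[of _ "N - c"])
  have p2: "m (66 + 2 * n + Suc ((n - c) mod n)) = int (hd L)"
    using b(1) pos_hd n5 by (simp add: base_def tab_def)
  have t': "m (69 + (4 * n + j)) = T_num N (Suc j)" "m (68 + (4 * n + j)) = T_num N j"
    "m (2 * n + 65) = int (n - c)" "m (67 + ((n - c) mod n + 2 * n)) = int (hd L)"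
    using t p1 p2 by (simp_all add: algebra_simps mult_2)
  have MM: "T_num N (Suc j) - T_num N j = M_num N" using M_num_eq[of N] N4 unfolding jn by simp
  have m': "fold ex C0 m = m(1 := int (68 + 4 * n + j), 2 := T_num N j, 20 := int (n - c), 21 := int (hd L),
    22 := M_num N, 9 := 0, 8 := int (Suc j), 23 := 0)"
    using C0_exec[of m n j "n - c" "hd L", OF _ _ _ _ _ _ t'(3,4,1,2)] b(1) unfolding MM jn(5) by (simp add: base_def)
  have hr: "hd L \<le> n" using P len N4 hd_in_set[of L] by (cases L) (auto simp: is_nperm_def n_def)
  have Mb: "\<bar>M_num N\<bar> \<le> M" using M_num_bounds[OF N3] by (intro powM[of N]) (auto simp: n_def)
  have "bdd M (fold ex C0 m)" unfolding m'
    using b(3) table_bounds(3)[of j] Mb hr bigM jn by (intro bdd_upd) auto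
  moreover have "tab 0 (fold ex C0 m)"
  proof (rule tab_frame)
    show "tab 0 m" using b by (simp add: base_def)
  qed (simp add: m')
  moreover have "tables n (fold ex C0 m)"
    by (rule tables_frame[OF b(2)]) (simp_all add: m')
  ultimately show ?thesis using b jn unfolding I4_def base2_def base_def by (simp add: m' moved_def)
qed

lemma C1_step: "I4 (Suc k) m \<Longrightarrow> I4 k (fold ex (C1a @ C1b) m)"
proof -
  assume I: "I4 (Suc k) m"
  define s where "s = N - 1 - Suc k"
  have s: "s < N - 1" "N - 1 - k = Suc s" using I N4 by (auto simp: I4_def s_def)
  have b: "base2 m" "m 8 = int (Suc k)" "m 9 = int s" "bdd M m"
    "m 23 = (\<Sum>j\<in>moved N L s. int n ^ j)" "\<forall>t<s. m (70 + 6 * n + t) = int (jpos N (ups t))"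
    using I by (auto simp: I4_def s_def)
  define v where "v = front N (hd L) s"
  define q where "q = ipos v L"
  have v: "v \<in> {1..N}" using front_range[of N] N4 by (simp add: v_def)
  obtain i where i: "i < n" "\<pi> ! i = v" "(int (Suc i) - int (n - c) - 1) mod int n = int q"
    using pos_val[OF v] unfolding q_def by blast
  have "m (65 + n + v) = int (Suc i)" using b(1) i by (auto simp: base2_def base_def tab_def)
  then have iv: "m (65 + n + Suc ((hd L + s) mod N)) = int (Suc i)" by (simp add: v_def front_def)
  have m1: "fold ex C1a m = m(1 := int (65 + n + v), 2 := int q)"
    using C1a_exec[of m n N "hd L" s "int (Suc i)", OF _ _ _ _ _ _ iv] b i(3) by (simp add: base2_def base_def v_def front_def)
  have qN: "q < N" using nth_ipos(1)[of v L] v P len by (auto simp: q_def is_nperm_def)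
  have fin: "finite (moved N L s)" "card (moved N L s) < N"
    using moved_bounds[OF P N3, of s] s by auto
  have qm: "q \<notin> moved N L s" using front_moved[OF P N3, of s s] s by (simp add: q_def v_def)
  have G: "m 23 = int (\<Sum>j\<in>moved N L s. n ^ j)" using b(5) by simp
  have "(\<Sum>j\<in>moved N L s. n ^ j) div n ^ q mod N + q = jpos N (ups s)"
    using count_above[OF fin(1) qm fin(2)] jpos_ups[OF P N3, of s] s N4
    by (simp add: ups_def n_def q_def v_def)
  then have cnt: "m 23 div int n ^ q mod int N + int q = int (jpos N (ups s))"
    unfolding G by (metis of_nat_add of_nat_power zdiv_int zmod_int)
  have m2: "fold ex (C1a @ C1b) m = m(1 := int (70 + 6 * n + s), 2 := int q, 3 := int n ^ q,
      4 := int (jpos N (ups s)), 70 + 6 * n + s := int (jpos N (ups s)), 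
      23 := (\<Sum>j\<in>moved N L (Suc s). int n ^ j), 9 := int (Suc s), 8 := int k)"
  proof -
    have sm: "m 23 + int n ^ q = (\<Sum>j\<in>moved N L (Suc s). int n ^ j)"
      using b(5) qm fin(1) unfolding moved_Suc q_def v_def by (simp add: add.commute)
    have tq: "m (67 + 3 * n + q) = int n ^ q" using b(1) qN by (simp add: base2_def tables_def n_def)
    have "fold ex C1b (m(1 := int (65 + n + v), 2 := int q)) = (m(1 := int (65 + n + v), 2 := int q))
       (1 := int (70 + 6 * n + s), 3 := int n ^ q, 4 := int (jpos N (ups s)),
        70 + 6 * n + s := int (jpos N (ups s)), 23 := m 23 + int n ^ q, 9 := int (Suc s), 8 := int k)"
      using C1b_exec[of "m(1 := int (65 + n + v), 2 := int q)" N n s k q "int n ^ q" "jpos N (ups s)"] b cnt tq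
      by (simp add: base2_def base_def)
    then show ?thesis unfolding fold_append comp_apply m1 sm by (auto simp: fun_eq_iff)
  qed
  have jb: "jpos N (ups s) \<le> N - 1" using jpos_bounds(2)[OF ups_nperm[OF P N3] N3] by (simp add: ups_def)
  have "(\<Sum>j\<in>moved N L (Suc s). n ^ j) < n ^ N"
    using moved_bounds[OF P N3] n5 by (intro sum_powers_less) auto
  then have "(\<Sum>j\<in>moved N L (Suc s). int n ^ j) \<le> int n ^ N"
    by (metis (no_types, lifting) less_imp_le of_nat_le_iff of_nat_power of_nat_sum sum.cong)
  moreover have "0 \<le> (\<Sum>j\<in>moved N L (Suc s). int n ^ j)" by (intro sum_nonneg) auto
  ultimately have "\<bar>\<Sum>j\<in>moved N L (Suc s). int n ^ j\<bar> \<le> M"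
    by (intro powM[of N]) (auto simp: n_def)
  then have "bdd M (fold ex (C1a @ C1b) m)" unfolding m2
  proof (intro bdd_upd)
    show "bdd M m" by (rule b(4))
    show "\<bar>int n ^ q\<bar> \<le> M" using table_bounds(1)[of q] qN by (simp add: n_def)
  qed (use bigM qN jb s I in \<open>simp_all add: n_def I4_def\<close>)
  moreover have "tab 0 (fold ex (C1a @ C1b) m)"
  proof (rule tab_frame)
    show "tab 0 m" using b by (simp add: base2_def base_def)
  qed (simp add: m2 del: fold_append)
  moreover have "tables n (fold ex (C1a @ C1b) m)"
  proof (rule tables_frame)
    show "tables n m" using b by (simp add: base2_def)
  qed (simp_all add: m2 del: fold_append)
  moreover have "\<forall>t<Suc s. fold ex (C1a @ C1b) m (70 + 6 * n + t) = int (jpos N (ups t))"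
    using b(6) by (auto simp: m2 less_Suc_eq simp del: fold_append)
  moreover have "base2 m" using b by simp
  ultimately show ?thesis using I unfolding I4_def base2_def base_def s(2) by (auto simp: m2 simp del: fold_append)
qed

section \<open>Evaluation of the recursion from the spine down to \<open>L\<close>\<close>

definition base3 :: "mem \<Rightarrow> bool" where
  "base3 m \<longleftrightarrow> base2 m \<and> (\<forall>s<N - 1. m (70 + 6 * n + s) = int (jpos N (ups s)))"

text \<open>Register 26 is left unspecified only at the starting index \<open>N - 1\<close> with
  complete run, where it holds the placeholder.\<close>

definition I5 :: "nat \<Rightarrow> mem \<Rightarrow> bool" where
  "I5 k m \<longleftrightarrow> bdd M m \<and> base3 m \<and> k \<le> N - 1 \<and> m 8 = int k \<and> m 24 = int (run N (ups k))
    \<and> m 25 = (if run N (ups k) = N then 1 else 0)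
    \<and> (run N (ups k) \<noteq> N \<or> k < N - 1 \<longrightarrow> m 26 = Y_num N (ups k))"

lemma base3_frame:
  assumes "base3 m" "\<And>a. 65 + n \<le> a \<Longrightarrow> m' a = m a"
    "\<And>a. a \<in> {0, 6, 7, 10, 11, 12, 13, 14, 15, 20, 21, 22} \<Longrightarrow> m' a = m a"
  shows "base3 m'"
proof -
  have b: "tab 0 m" "tables n m" "\<forall>s<N - 1. m (70 + 6 * n + s) = int (jpos N (ups s))"
    using assms(1) unfolding base3_def base2_def base_def by blast+
  have "tab 0 m'" by (rule tab_frame[OF b(1)]) (rule assms(2))
  moreover have "tables n m'" by (rule tables_frame[OF b(2)]) (simp_all add: assms(2))
  moreover have "\<forall>s<N - 1. m' (70 + 6 * n + s) = int (jpos N (ups s))"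
    using b(3) by (simp add: assms(2))
  moreover have "m' 0 = m 0" "m' 6 = m 6" "m' 7 = m 7" "m' 10 = m 10" "m' 11 = m 11" "m' 12 = m 12"
    "m' 13 = m 13" "m' 14 = m 14" "m' 15 = m 15" "m' 20 = m 20" "m' 21 = m 21" "m' 22 = m 22"
    by (rule assms(3), simp)+
  ultimately show ?thesis
    using assms(1) unfolding base3_def base2_def base_def by (elim conjE, intro conjI) (assumption | simp only:)+
qed

lemma ups_facts: "is_nperm N (ups s)" "up N (ups s) = ups (Suc s)" "hd (ups s) mod N = (hd L + s) mod N"
  using ups_nperm[OF P N3] hd_ups(1)[OF P N3] by (auto simp: ups_def)

lemma run_last: "run N (ups (N - 1)) = N"
  using run_ups[OF P N3, of "N - 1"] run_le_N[OF ups_facts(1)] N4 by (simp add: ups_def le_antisym)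

lemma D0_post: "I4 0 m \<Longrightarrow> I5 (N - 1) (fold ex D0 m)"
proof -
  assume I: "I4 0 m"
  have b: "base3 m" "bdd M m" using I by (auto simp: I4_def base3_def)
  have m': "fold ex D0 m = m(25 := 1, 8 := int (N - 1), 24 := int N, 26 := 0)"
    using D0_exec[of m "N - 1"] b N4 by (simp add: base3_def base2_def base_def)
  have "bdd M (fold ex D0 m)" unfolding m'
    using b bigM by (intro bdd_upd) (auto simp: n_def)
  moreover have "base3 (fold ex D0 m)" using b(1) by (rule base3_frame) (auto simp: m')
  ultimately show ?thesis using run_last unfolding I5_def by (simp add: m')
qed

lemma D1_step: "I5 (Suc s) m \<Longrightarrow> I5 s (fold ex (D1a @ D1b @ D1c) m)"
proof -
  assume I: "I5 (Suc s) m"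
  define X where "X = ups s"
  have X: "is_nperm N X" "up N X = ups (Suc s)" using ups_facts by (auto simp: X_def)
  have s: "s < N - 1" using I by (simp add: I5_def)
  have b3: "base3 m" and bd: "bdd M m" and r8: "m 8 = int (Suc s)" using I by (auto simp: I5_def)
  then have b: "m 0 = int n" "m 6 = 1" "m 7 = int N" "m 13 = int (68 + 4 * n)" "m 14 = int (69 + 5 * n)"
    "m 15 = int (70 + 6 * n)" "m 21 = int (hd L)" "m 22 = M_num N" "tables n m"
    "m (70 + 6 * n + s) = int (jpos N X)"
    using s by (auto simp: base3_def base2_def base_def X_def)
  define u where "u = run N (up N X)"
  define p where "p = jpos N X"
  define f where "f = (if u = N then 1 else 0 :: int)"
  define r where "r = min p (u - 1)"
  have ub: "2 \<le> u" "u \<le> N" using up_run_ge2[OF X(1) N3] run_le_N[OF up_nperm[OF X(1) N3]] by (auto simp: u_def)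
  have pb: "1 \<le> p" "p \<le> N - 1" using jpos_bounds[OF X(1) N3] by (auto simp: p_def)
  have r24: "m 24 = int u" "m 25 = f" using I X by (auto simp: I5_def u_def f_def)
  have r26: "u \<noteq> N \<Longrightarrow> m 26 = Y_num N (up N X)" using I X by (auto simp: I5_def u_def)
  have Yo: "m 26 + ((m 22 - 2) * (int ((hd L + s) mod N) + 1) + int N + int N - m 26) * m 25 = Yo_num N X"
    using r26 b(8) r24(2) ups_facts(3)[of s]
    by (simp add: Yo_num_def f_def u_def X_def mult.commute split: if_splits)
  have m1: "fold ex D1a m = m(8 := int s, 1 := int (70 + 6 * n + s), 2 := 2, 4 := int p, 3 := Yo_num N X)"
    using D1a_exec[OF b(2,3) r8 b(6,7,10)] unfolding Yo p_def by simp
  define m1 where "m1 = m(8 := int s, 1 := int (70 + 6 * n + s), 2 := 2, 4 := int p, 3 := Yo_num N X)"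
  define f' where "f' = (if run N X = N then 1 else 0 :: int)"
  have rX: "run N X = (if u = N \<and> p = N - 1 then N else r)"
    using run_rec[OF X(1) N3] by (simp add: u_def p_def r_def)
  have full: "run N X = N \<longleftrightarrow> u = N \<and> p = N - 1" using rX pb N4 by (auto simp: r_def)
  have "(int p + 1) div int N = (if p = N - 1 then 1 else 0)"
  proof (cases "p = N - 1")
    case True
    then have "int p + 1 = int N" using N4 by simp
    then show ?thesis using True N4 by simp
  next
    case False
    then have "0 \<le> int p + 1" "int p + 1 < int N" using pb by auto
    then show ?thesis using False by (simp add: div_pos_pos_trivial)
  qed
  then have ff: "f * ((int p + 1) div int N) = f'" using full by (simp add: f_def f'_def)
  have rr: "int u - 1 - (int p - (int u - 1)) * ((int p - (int u - 1)) div int N) = int r"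
  proof (cases "int u - 1 \<le> int p")
    case True
    then have "(int p - (int u - 1)) div int N = 0" using pb ub by (intro div_pos_pos_trivial) auto
    then show ?thesis using True ub by (simp add: r_def of_nat_diff)
  next
    case False
    then have "(int p - (int u - 1)) div int N = -1" using pb ub by (intro div_eq_minus_one) auto
    then show ?thesis using False ub by (simp add: r_def)
  qed
  define d where "d = int p - (int u - 1)"
  have m2: "fold ex D1b m1 = m1(25 := f', 2 := d div int N, 1 := d * (d div int N), 24 := int r)"
    using D1b_exec[of m1] b r24 ff rr by (simp add: m1_def d_def)
  define m2 where "m2 = m1(25 := f', 2 := d div int N, 1 := d * (d div int N), 24 := int r)"
  have r1: "1 \<le> r" "r \<le> N - 1" using pb ub by (auto simp: r_def)
  have tu: "m (68 + 4 * n + (r - 1)) = T_num N (r - 1)" "m (69 + 5 * n + (r - 1)) = U_num N (r - 1)"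
  proof -
    have "r - 1 < n" using r1 by (simp add: n_def)
    then show "m (68 + 4 * n + (r - 1)) = T_num N (r - 1)" "m (69 + 5 * n + (r - 1)) = U_num N (r - 1)"
      using b(9) unfolding tables_def by blast+
  qed
  have Yv: "Yo_num N X - U_num N (r - 1) - (int p - int r - 1) * T_num N (r - 1) - (int n + 1) * int p + int n = Y_num N X"
    using Y_rec[OF X(1) N3 r_def[unfolded p_def u_def]] by (simp add: n_def p_def)
  have Rv: "int r + f' = int (run N X)" using rX full r1 pb N4 by (auto simp: f'_def r_def)
  have m3: "fold ex D1c m2 = m2(1 := (int n + 1) * int p, 2 := U_num N (r - 1), 3 := 0, 5 := T_num N (r - 1),
      26 := Y_num N X, 24 := int (run N X))"
  proof -
    have S: "Suc (r - 1) = r" using r1 by simp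
    have "fold ex D1c m2 = m2(1 := (int n + 1) * m2 4, 2 := U_num N (r - 1), 3 := 0, 5 := T_num N (r - 1),
      26 := m2 3 - U_num N (r - 1) - (m2 4 - int (Suc (r - 1)) - 1) * T_num N (r - 1) - (int n + 1) * m2 4 + int n,
      24 := int (Suc (r - 1)) + m2 25)"
      using b tu S by (intro D1c_exec) (simp_all add: m2_def m1_def)
    moreover have "m2 4 = int p" "m2 3 = Yo_num N X" "m2 25 = f'" by (simp_all add: m2_def m1_def)
    ultimately show ?thesis using Yv Rv unfolding S by simp
  qed
  have fin: "fold ex (D1a @ D1b @ D1c) m = m(8 := int s, 4 := int p, 25 := f', 1 := (int n + 1) * int p,
     2 := U_num N (r - 1), 3 := 0, 5 := T_num N (r - 1), 26 := Y_num N X, 24 := int (run N X))"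
    unfolding fold_append comp_apply m1 m1_def[symmetric] m2 m2_def[symmetric] m3
    by (auto simp: m2_def m1_def fun_eq_iff)
  have Yb: "\<bar>Y_num N X\<bar> \<le> M"
    using Y_num_ups_le[OF P N3, of s] Y_num_nonneg[OF X(1) N3] s N4
    by (intro powM[of "N + 4"]) (auto simp: n_def X_def ups_def)
  have pp: "\<bar>(int n + 1) * int p\<bar> \<le> M"
  proof (rule powM[of 2])
    have "(n + 1) * p \<le> (n + 1) * (n - 1)" using pb by (intro mult_left_mono) (auto simp: n_def)
    also have "\<dots> \<le> n ^ 2" by (simp add: power2_eq_square algebra_simps diff_mult_distrib2)
    finally have "int ((n + 1) * p) \<le> int (n ^ 2)" by (simp only: of_nat_le_iff)
    then show "\<bar>(int n + 1) * int p\<bar> \<le> int n ^ 2" by (simp add: abs_mult algebra_simps)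
  qed (use n5 in simp)
  have "\<bar>f'\<bar> \<le> M" using M100 by (simp add: f'_def)
  then have "bdd M (fold ex (D1a @ D1b @ D1c) m)" unfolding fin
  proof (intro bdd_upd)
    show "bdd M m" by (rule bd)
    show "\<bar>(int n + 1) * int p\<bar> \<le> M" "\<bar>Y_num N X\<bar> \<le> M" "\<bar>f'\<bar> \<le> M" by fact+
    show "\<bar>U_num N (r - 1)\<bar> \<le> M" "\<bar>T_num N (r - 1)\<bar> \<le> M" using table_bounds(3,4)[of "r - 1"] r1 by (simp_all add: n_def)
  qed (use bigM s pb run_le_N[OF X(1)] in \<open>simp_all add: n_def\<close>)
  moreover have "base3 (fold ex (D1a @ D1b @ D1c) m)" using b3 by (rule base3_frame) (auto simp: fin simp del: fold_append)
  ultimately show ?thesis using s unfolding I5_def X_def[symmetric] by (simp add: fin f'_def del: fold_append)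
qed

lemma E0_post: "I5 0 m \<Longrightarrow> fold ex E0 m 0 = int (rank n \<pi>)"
proof -
  assume I: "I5 0 m"
  then have b: "m 0 = int n" "m 6 = 1" "m 7 = int N" "m 13 = int (68 + 4 * n)"
    "m 15 = int (70 + 6 * n)" "m 20 = int (n - c)" "m 21 = int (hd L)" "m 22 = M_num N" "tables n m"
    "m 24 = int (run N L)" "m 25 = (if run N L = N then 1 else 0)"
    "m 26 = Y_num N L"
    using N4 by (auto simp: I5_def base3_def base2_def base_def ups_def)
  have "\<forall>s<N - 1. m (70 + 6 * n + s) = int (jpos N (ups s))" using I by (simp add: I5_def base3_def)
  then have p0: "m (70 + 6 * n) = int (jpos N L)" using N4 by (auto simp: ups_def dest!: spec[of _ 0])
  have L: "L \<noteq> []" using len N4 by auto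
  define r where "r = (if run N L = N then N - 2 else run N L - 1)"
  have r0: "1 \<le> run N L" "run N L \<le> N" using run_pos[OF L] run_le_N[OF P] by auto
  have r: "m 24 - m 25 - 1 = int r" using r0 N4 by (simp add: b r_def of_nat_diff)
  have t: "m (68 + (4 * n + r)) = T_num N r"
  proof -
    have "r < n" using r0 by (auto simp: r_def n_def)
    then have "m (68 + 4 * n + r) = T_num N r" using b(9) unfolding tables_def by blast
    then show ?thesis by (simp only: add.assoc)
  qed
  have c': "m 20 = int n - int c" using c by (simp add: b n_def)
  have Z: "T_num N r + (int (hd L mod N) * m 22 - T_num N r) * m 25 = Z_num N L"
    by (simp add: b Z_num_def r_def)
  have pb: "jpos N L \<le> N - 1" using jpos_bounds[OF P N3] by auto
  have flag: "(int c - int (jpos N L)) div int n + 1 = (if jpos N L \<le> c then 1 else 0)"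
  proof (cases "jpos N L \<le> c")
    case True
    then have "(int c - int (jpos N L)) div int n = 0" using c by (intro div_pos_pos_trivial) (auto simp: n_def)
    then show ?thesis using True by simp
  next
    case False
    then have "(int c - int (jpos N L)) div int n = -1" using pb by (intro div_eq_minus_one) (auto simp: n_def)
    then show ?thesis using False by simp
  qed
  have "fold ex E0 m 0 = Y_num N L + int c - (Z_num N L + int n) * (if jpos N L \<le> c then 1 else 0)"
    using E0_exec[OF b(1-5) r c' b(7) t p0] unfolding Z flag b(12) by simp
  also have "\<dots> = val N L c" by (simp add: val_def n_def)
  finally show ?thesis using rank_mk[OF P N3 c] by (simp add: n_def \<pi>_def)
qed

lemma ranking_code_correct:
  "triple M I0 ranking_code (400 * n) (\<lambda>m. m 0 = int (rank n \<pi>))"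
proof -
  have st: "list_all (straight M) X" if "X \<in> {A0, A1, [LoadC 2 5], A3, B0, B1, C0, C1a @ C1b, D0, D1a @ D1b @ D1c, E0}" for X
    using that M100 by (auto simp: A0_def A1_def A3_def B0_def B1_def C0_def C1a_def C1b_def D0_def
        D1a_def D1b_def D1c_def E0_def)
  have ln: "length X \<le> 64" if "X \<in> {A0, A1, [LoadC 2 5], A3, B0, B1, C0, C1a @ C1b, D0, D1a @ D1b @ D1c, E0}" for X
    using that by (auto simp: A0_def A1_def A3_def B0_def B1_def C0_def C1a_def C1b_def D0_def
        D1a_def D1b_def D1c_def E0_def)
  have inv: "\<And>k m. I1 k m \<Longrightarrow> bdd M m \<and> m 2 = int k" "\<And>k m. I2 k m \<Longrightarrow> bdd M m \<and> m 2 = int k"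
    "\<And>k m. I3 k m \<Longrightarrow> bdd M m \<and> m 8 = int k" "\<And>k m. I4 k m \<Longrightarrow> bdd M m \<and> m 8 = int k"
    "\<And>k m. I5 k m \<Longrightarrow> bdd M m \<and> m 8 = int k"
    by (auto simp: I1_def I2_def I3_def I4_def I5_def)
  have 1: "triple M I0 (block A0) (length A0) (I1 (n - 5))"
    using I0_facts A0_post by (intro triple_block M2 st ln) simp_all
  have 2: "triple M (I1 (n - 5)) (while_pos 2 A1) ((n - 5) * (length A1 + 2) + 1) (I1 0)"
    by (rule triple_while[where I = I1 and xs = "A1" and r = 2, OF inv(1) A1_step M2 st ln]) simp_all
  have 3: "triple M (I1 0) (block [LoadC 2 5]) (length [LoadC 2 5]) (I2 5)"
    using inv(1) A2_post by (intro triple_block M2 st ln) simp_all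
  have 4: "triple M (I2 5) (while_pos 2 A3) (5 * (length A3 + 2) + 1) (I2 0)"
    by (rule triple_while[where I = I2 and xs = "A3" and r = 2, OF inv(2) A3_step M2 st ln]) simp_all
  have 5: "triple M (I2 0) (block B0) (length B0) (I3 n)"
    using inv(2) B0_post by (intro triple_block M2 st ln) simp_all
  have 6: "triple M (I3 n) (while_pos 8 B1) (n * (length B1 + 2) + 1) (I3 0)"
    by (rule triple_while[where I = I3 and xs = "B1" and r = 8, OF inv(3) B1_step M2 st ln]) simp_all
  have 7: "triple M (I3 0) (block C0) (length C0) (I4 (N - 1))"
    using inv(3) C0_post by (intro triple_block M2 st ln) simp_all
  have 8: "triple M (I4 (N - 1)) (while_pos 8 (C1a @ C1b)) ((N - 1) * (length (C1a @ C1b) + 2) + 1) (I4 0)"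
    by (rule triple_while[where I = I4 and xs = "C1a @ C1b" and r = 8, OF inv(4) C1_step M2 st ln]) simp_all
  have 9: "triple M (I4 0) (block D0) (length D0) (I5 (N - 1))"
    using inv(4) D0_post by (intro triple_block M2 st ln) simp_all
  have 10: "triple M (I5 (N - 1)) (while_pos 8 (D1a @ D1b @ D1c)) ((N - 1) * (length (D1a @ D1b @ D1c) + 2) + 1) (I5 0)"
    by (rule triple_while[where I = I5 and xs = "D1a @ D1b @ D1c" and r = 8, OF inv(5) D1_step M2 st ln]) simp_all
  have 11: "triple M (I5 0) (block E0) (length E0) (\<lambda>m. m 0 = int (rank n \<pi>))"
    using inv(5) E0_post by (intro triple_block M2 st ln) simp_all
  note all = triple_seq[OF 1 triple_seq[OF 2 triple_seq[OF 3 triple_seq[OF 4 triple_seq[OF 5 triple_seq[OF 6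
      triple_seq[OF 7 triple_seq[OF 8 triple_seq[OF 9 triple_seq[OF 10 11]]]]]]]]]]
  show ?thesis unfolding ranking_code_def
    by (rule triple_mono[OF all])
      (use n5 in \<open>simp add: A0_def A1_def A3_def B0_def B1_def C0_def C1a_def C1b_def D0_def D1a_def D1b_def D1c_def E0_def n_def\<close>)
qed

end

text \<open>The exponent is a constant: n^(2n) is at most (n!)^4, and \<open>cap\<close> raises it
  to the power 2^64.\<close>

lemma fact_bound:
  assumes "5 \<le> n"
  shows "cap (int n ^ (2 * n)) \<le> int (fact n) ^ (4 * 2 ^ 64)"
proof -
  have "int (n ^ n) \<le> int (fact n ^ 2)" using power_self_le_fact_square[of n] by (simp only: of_nat_le_iff)
  then have "(int n ^ n) ^ 2 \<le> (int (fact n) ^ 2) ^ 2" by (intro power_mono) simp_all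
  then have "int n ^ (2 * n) \<le> int (fact n) ^ 4" by (simp add: power_mult[symmetric] mult.commute)
  then have "(int n ^ (2 * n)) ^ (2 ^ 64) \<le> (int (fact n) ^ 4) ^ (2 ^ 64)" by (intro power_mono) simp_all
  then show ?thesis unfolding cap_def power_mult .
qed

theorem mainTheorem10:
  shows "\<exists>(prog :: instr list) (C :: real) (K :: nat).
    \<forall>n \<ge> 5. \<forall>\<pi>. is_nperm n \<pi> \<longrightarrow>
      (\<exists>t. real t \<le> C * real n * sqrt (ln (real n))
         \<and> halted prog ((step prog ^^ t) (init_config \<pi>))
         \<and> snd ((step prog ^^ t) (init_config \<pi>)) 0 = int (rank n \<pi>)
         \<and> (\<forall>s \<le> t. \<forall>a. \<bar>snd ((step prog ^^ s) (init_config \<pi>)) a\<bar> \<le> int (fact n) ^ K))"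
proof (rule exI[of _ "ranking_code 0"], rule exI[of _ "400 :: real"], rule exI[of _ "4 * 2 ^ 64 :: nat"],
    intro allI impI)
  fix n \<pi> assume n: "5 \<le> n" and p: "is_nperm n \<pi>"
  let ?p = "ranking_code 0"
  obtain N where N: "n = Suc N" using n by (cases n) auto
  obtain L c where L: "is_nperm N L" "c \<le> N" "\<pi> = mk L c" using mk_surj[of N \<pi>] p N by auto
  interpret r: ranking_input N L c using n N L by unfold_locales auto
  have rn: "r.n = n" "r.\<pi> = \<pi>" "r.M = int n ^ (2 * n)" by (simp_all add: r.n_def r.\<pi>_def r.M_def N L)
  have i: "init_config \<pi> = (0, snd (init_config \<pi>))" by (simp add: init_config_def)
  obtain t m' where t: "t \<le> 400 * n" "m' 0 = int (rank n \<pi>)"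
    "trace ?p (cap (int n ^ (2 * n))) t (init_config \<pi>) (length ?p, m')"
    using r.ranking_code_correct[unfolded triple_def rn, rule_format, of "snd (init_config \<pi>)" "[]" "[]"] i
    by (auto simp: r.I0_def rn)
  \<comment> \<open>As n \<ge> 5 exceeds e, the factor sqrt(ln n) is at least 1 and the linear bound
    suffices.\<close>
  have "1 \<le> ln (real n)"
  proof -
    have "exp 1 \<le> real n" using exp_le n by linarith
    then show ?thesis using ln_mono[of "exp 1" "real n"] n by simp
  qed
  then have "1 \<le> sqrt (ln (real n))" by simp
  then have "400 * real n * 1 \<le> 400 * real n * sqrt (ln (real n))" by (intro mult_left_mono) auto
  moreover have "real t \<le> 400 * real n" using t(1) by (metis of_nat_le_iff of_nat_mult of_nat_numeral)
  ultimately have time: "real t \<le> 400 * real n * sqrt (ln (real n))" by linarith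
  have "\<bar>snd ((step ?p ^^ s) (init_config \<pi>)) a\<bar> \<le> int (fact n) ^ (4 * 2 ^ 64)" if "s \<le> t" for s a
    using t(3) that fact_bound[OF n] unfolding trace_def bdd_def by (meson order_trans)
  then show "\<exists>t. real t \<le> 400 * real n * sqrt (ln (real n))
         \<and> halted ?p ((step ?p ^^ t) (init_config \<pi>))
         \<and> snd ((step ?p ^^ t) (init_config \<pi>)) 0 = int (rank n \<pi>)
         \<and> (\<forall>s \<le> t. \<forall>a. \<bar>snd ((step ?p ^^ s) (init_config \<pi>)) a\<bar> \<le> int (fact n) ^ (4 * 2 ^ 64))"
    using t time by (intro exI[of _ t]) (auto simp: trace_def halted_def)
qed

end
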